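(* A colax monoidal functor $F : \mathcal V \to \mathcal W$ between monoidal categories is exact as a colax morphism of pseudo $\mathbf M$-algebras if and only if both of the following hold: (1) For any $X \in \mathcal V$ and $f : FX \to I$ in $\mathcal W$, there is a unique $g : X \to I$ in $\mathcal V$ such that $f = \overline F_0F(g)$. (2) For any $X \in \mathcal V$, $Y_1,Y_2 \in \mathcal W$ and $f : FX \to Y_1\otimes Y_2$, the category $\mathrm{Fact}_F(X,f,Y_1,Y_2)$ is connected.
   Context: $\mathbf M$ is the 2-monad on $\mathbf{CAT}$ (the 2-category of possibly large, locally small categories) for monoidal categories: $\mathbf M\mathcal V$ has as objects finite sequences of objects of $\mathcal V$, and morphisms $(x_1,\dots,x_n) \to (y_1,\dots,y_n)$ (only between sequences of equal length) are sequences of morphisms $x_i \to y_i$. A monoidal category $\mathcal V$ is a pseudo $\mathbf M$-algebra via $n$-ary tensor products $\bigotimes : \mathbf M\mathcal V \to \mathcal V$. A colax monoidal functor $F$ has coherences $\overline F_0 : FI \to I$ and $\overline F_2 : F(Z_1\otimes Z_2) \to FZ_1\otimes FZ_2$, hence $\overline F_n : F\bigotimes_{i=1}^nZ_i \to \bigotimes_{i=1}^nFZ_i$ for all $n$; these are the components of a natural transformation $\overline F : F\bigotimes \to \bigotimes\mathbf M(F)$ making $F$ a colax morphism of pseudo $\mathbf M$-algebras ($I$ denotes the tensor unit). **Exactness.** A lax square of categories, $p : P \to A$, $q : P \to B$, $f : A \to C$, $g : B \to C$, $\phi : fp \to gq$, is exact if for every natural transformation $\psi : h \to lf$ exhibiting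 $l$ as a pointwise left Kan extension of $h$ along $f$, the composite $(l\phi)(\psi p) : hp \to lgq$ exhibits $lg$ as a pointwise left Kan extension of $hp$ along $q$. $F$ is exact as a colax morphism of pseudo $\mathbf M$-algebras if the lax square with $P = \mathbf M\mathcal V$, $p = \bigotimes : \mathbf M\mathcal V \to \mathcal V$, $q = \mathbf M(F) : \mathbf M\mathcal V \to \mathbf M\mathcal W$, bottom $F : \mathcal V \to \mathcal W$, right side $\bigotimes : \mathbf M\mathcal W \to \mathcal W$ and 2-cell $\overline F : F\bigotimes \to \bigotimes\mathbf M(F)$ is exact. **The category $\mathrm{Fact}_F(X,f,Y_1,Y_2)$.** For $f : FX \to Y_1\otimes Y_2$, its objects are 5-tuples $(g,Z_1,Z_2,h_1,h_2)$ with $Z_1,Z_2 \in \mathcal V$, $g : X \to Z_1\otimes Z_2$, $h_i : FZ_i \to Y_i$, such that the composite $FX \xrightarrow{Fg} F(Z_1\otimes Z_2) \xrightarrow{\overline F_2} FZ_1\otimes FZ_2 \xrightarrow{h_1\otimes h_2} Y_1\otimes Y_2$ equals $f$. An arrow $(g,Z_1,Z_2,h_1,h_2) \to (g',Z'_1,Z'_2,h'_1,h'_2)$ is a pair $(k_1 : Z_1 \to Z'_1,\ k_2 : Z_2 \to Z'_2)$ with $(k_1\otimes k_2)g = g'$, $h_1 = h'_1F(k_1)$ and $h_2 = h'_2F(k_2)$. A category is connected if it is non-empty and any two objects are joined by an undirected path of arrows. *)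

theory Defs
  imports Main "HOL-Library.FuncSet"
begin

unbundle cardinal_syntax

section \<open>Categories, functors, natural transformations\<close>

record ('o, 'a) cat =
  Obj :: "'o set"
  Arr :: "'a set"
  Src :: "'a \<Rightarrow> 'o"
  Trg :: "'a \<Rightarrow> 'o"
  Ident :: "'o \<Rightarrow> 'a"
  Comp :: "'a \<Rightarrow> 'a \<Rightarrow> 'a"  (infixl "\<cdot>\<index>" 75)

definition hom :: "('o, 'a, 'm) cat_scheme \<Rightarrow> 'o \<Rightarrow> 'o \<Rightarrow> 'a set" where
  "hom C x y = {f \<in> Arr C. Src C f = x \<and> Trg C f = y}"

text \<open>\<open>g \<cdot> f\<close> is the composite "first f, then g"; it is meaningful only if the target
  of \<open>f\<close> is the source of \<open>g\<close>.\<close>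

locale category =
  fixes C :: "('o, 'a, 'm) cat_scheme" (structure)
  assumes Src_closed: "f \<in> Arr C \<Longrightarrow> Src C f \<in> Obj C"
    and Trg_closed: "f \<in> Arr C \<Longrightarrow> Trg C f \<in> Obj C"
    and Ident_hom: "x \<in> Obj C \<Longrightarrow> Ident C x \<in> hom C x x"
    and Comp_hom: "f \<in> hom C x y \<Longrightarrow> g \<in> hom C y z \<Longrightarrow> g \<cdot> f \<in> hom C x z"
    and Comp_Ident: "f \<in> hom C x y \<Longrightarrow> f \<cdot> Ident C x = f"
    and Ident_Comp: "f \<in> hom C x y \<Longrightarrow> Ident C y \<cdot> f = f"
    and Comp_assoc: "f \<in> hom C w x \<Longrightarrow> g \<in> hom C x y \<Longrightarrow> h \<in> hom C y z
      \<Longrightarrow> (h \<cdot> g) \<cdot> f = h \<cdot> (g \<cdot> f)"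

definition iso :: "('o, 'a, 'm) cat_scheme \<Rightarrow> 'o \<Rightarrow> 'o \<Rightarrow> 'a \<Rightarrow> bool" where
  "iso C x y f \<longleftrightarrow> f \<in> hom C x y \<and>
     (\<exists>g \<in> hom C y x. g \<cdot>\<^bsub>C\<^esub> f = Ident C x \<and> f \<cdot>\<^bsub>C\<^esub> g = Ident C y)"

definition connected_category :: "('o, 'a, 'm) cat_scheme \<Rightarrow> bool" where
  "connected_category C \<longleftrightarrow> Obj C \<noteq> {} \<and>
     (let E = (\<lambda>k. (Src C k, Trg C k)) ` Arr C
      in \<forall>x \<in> Obj C. \<forall>y \<in> Obj C. (x, y) \<in> (E \<union> E\<inverse>)\<^sup>*)"

record ('o, 'a, 'p, 'b) ftor =
  onObj :: "'o \<Rightarrow> 'p"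
  onArr :: "'a \<Rightarrow> 'b"

locale cat_functor = A: category A + B: category B
  for A :: "('o, 'a, 'm) cat_scheme" and B :: "('p, 'b, 'n) cat_scheme" +
  fixes F :: "('o, 'a, 'p, 'b, 'k) ftor_scheme"
  assumes onObj_closed: "x \<in> Obj A \<Longrightarrow> onObj F x \<in> Obj B"
    and onArr_hom: "f \<in> hom A x y \<Longrightarrow> onArr F f \<in> hom B (onObj F x) (onObj F y)"
    and onArr_Ident: "x \<in> Obj A \<Longrightarrow> onArr F (Ident A x) = Ident B (onObj F x)"
    and onArr_Comp: "f \<in> hom A x y \<Longrightarrow> g \<in> hom A y z
      \<Longrightarrow> onArr F (g \<cdot>\<^bsub>A\<^esub> f) = onArr F g \<cdot>\<^bsub>B\<^esub> onArr F f"

definition fcomp :: "('p, 'b, 'q, 'c, 'k) ftor_scheme \<Rightarrow> ('o, 'a, 'p, 'b, 'l) ftor_scheme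
    \<Rightarrow> ('o, 'a, 'q, 'c) ftor"  (infixr "\<circ>\<^sub>F" 55) where
  "G \<circ>\<^sub>F F = \<lparr>onObj = onObj G \<circ> onObj F, onArr = onArr G \<circ> onArr F\<rparr>"

definition nat_trans :: "('o, 'a, 'm) cat_scheme \<Rightarrow> ('p, 'b, 'n) cat_scheme
    \<Rightarrow> ('o, 'a, 'p, 'b, 'k) ftor_scheme \<Rightarrow> ('o, 'a, 'p, 'b, 'l) ftor_scheme
    \<Rightarrow> ('o \<Rightarrow> 'b) \<Rightarrow> bool" where
  "nat_trans A B F G \<alpha> \<longleftrightarrow> cat_functor A B F \<and> cat_functor A B G \<and>
     (\<forall>x \<in> Obj A. \<alpha> x \<in> hom B (onObj F x) (onObj G x)) \<and>
     (\<forall>x y. \<forall>f \<in> hom A x y. \<alpha> y \<cdot>\<^bsub>B\<^esub> onArr F f = onArr G f \<cdot>\<^bsub>B\<^esub> \<alpha> x)"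


section \<open>Size\<close>

text \<open>Sets of cardinality less than \<open>\<kappa>\<close> are the small ones; classes of objects and of arrows
  are only bounded by their types.\<close>

definition locally_small :: "'k rel \<Rightarrow> ('o, 'a, 'm) cat_scheme \<Rightarrow> bool" where
  "locally_small \<kappa> C \<longleftrightarrow> (\<forall>x \<in> Obj C. \<forall>y \<in> Obj C. |hom C x y| <o \<kappa>)"

text \<open>There is room, among the locally small categories with objects in \<open>'d\<close> and arrows in
  \<open>'e\<close>, for the category of small subsets of \<open>'s\<close> and all functions between them: its hom-sets
  are small, and its objects and its arrows (triples of domain, codomain and function) can be
  coded in \<open>'d\<close> and \<open>'e\<close>. This holds if \<open>\<kappa>\<close> is the cardinal of a Grothendieck universe and
  all three types have cardinality \<open>\<kappa>\<close>. For every type \<open>'s\<close> it also holds if \<open>\<kappa>\<close>, \<open>'d\<close>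
  and \<open>'e\<close> are large enough: see the lemma below, where every subset of \<open>'s\<close> is small.\<close>

definition accommodates_Set ::
    "'k rel \<Rightarrow> 's itself \<Rightarrow> 'd itself \<Rightarrow> 'e itself \<Rightarrow> bool" where
  "accommodates_Set \<kappa> ts td te \<longleftrightarrow>
     Card_order \<kappa> \<and> infinite (Field \<kappa>) \<and>
     (\<forall>(X :: 's set) (Y :: 's set). |X| <o \<kappa> \<longrightarrow> |Y| <o \<kappa> \<longrightarrow> |X \<rightarrow>\<^sub>E Y| <o \<kappa>) \<and>
     (\<exists>\<iota> :: 's set \<Rightarrow> 'd. inj_on \<iota> {X. |X| <o \<kappa>}) \<and>
     (\<exists>\<iota> :: 's set \<times> 's set \<times> ('s \<Rightarrow> 's) \<Rightarrow> 'e.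
        inj_on \<iota> {(X, Y, u). |X| <o \<kappa> \<and> |Y| <o \<kappa> \<and> u \<in> X \<rightarrow>\<^sub>E Y})"

lemma accommodates_Set_example:
  "accommodates_Set |UNIV :: ('s + nat) set set set|
     TYPE('s) TYPE('s set) TYPE('s set \<times> 's set \<times> ('s \<Rightarrow> 's))"
proof -
  let ?N = "UNIV :: ('s + nat) set" and ?\<kappa> = "|UNIV :: ('s + nat) set set set|"
  have "|X \<rightarrow>\<^sub>E Y| <o ?\<kappa>" for X Y :: "'s set"
  proof -
    have "|X \<rightarrow>\<^sub>E Y| \<le>o |Pow (?N \<times> ?N)|"
      unfolding card_of_ordLeq[symmetric]
      by (rule exI[of _ "\<lambda>u. {(Inl x, Inl (u x)) | x. True}"])
        (auto intro!: inj_onI ext simp: set_eq_iff, metis sum.inject(1))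
    also have "|Pow (?N \<times> ?N)| =o |Pow ?N|"
    proof -
      have "|?N \<times> ?N| =o |?N|"
        by (rule card_of_Times_same_infinite) simp
      then obtain b where "bij_betw b (?N \<times> ?N) ?N"
        using card_of_ordIso by blast
      then have "bij_betw (image b) (Pow (?N \<times> ?N)) (Pow ?N)"
        by (rule bij_betw_Pow)
      then show ?thesis
        using card_of_ordIso by blast
    qed
    also have "|Pow ?N| <o ?\<kappa>"
      by (metis card_of_Pow Pow_UNIV)
    finally show ?thesis .
  qed
  then show ?thesis
    unfolding accommodates_Set_def
    by (auto intro: exI[of _ id] exI[of _ "\<lambda>x. x"]
        simp: Finite_Set.finite_set card_of_card_order_on Field_card_of)
qed


section \<open>Pointwise left Kan extensions and exact squares\<close>

definition is_cocone :: "('i, 'j, 'm) cat_scheme \<Rightarrow> ('d, 'e, 'n) cat_scheme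
    \<Rightarrow> ('i, 'j, 'd, 'e, 'k) ftor_scheme \<Rightarrow> 'd \<Rightarrow> ('i \<Rightarrow> 'e) \<Rightarrow> bool" where
  "is_cocone J D T d \<gamma> \<longleftrightarrow> d \<in> Obj D \<and>
     (\<forall>i \<in> Obj J. \<gamma> i \<in> hom D (onObj T i) d) \<and>
     (\<forall>i j. \<forall>u \<in> hom J i j. \<gamma> j \<cdot>\<^bsub>D\<^esub> onArr T u = \<gamma> i)"

definition is_colimit :: "('i, 'j, 'm) cat_scheme \<Rightarrow> ('d, 'e, 'n) cat_scheme
    \<Rightarrow> ('i, 'j, 'd, 'e, 'k) ftor_scheme \<Rightarrow> 'd \<Rightarrow> ('i \<Rightarrow> 'e) \<Rightarrow> bool" where
  "is_colimit J D T d \<gamma> \<longleftrightarrow> is_cocone J D T d \<gamma> \<and>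
     (\<forall>d' \<gamma>'. is_cocone J D T d' \<gamma>' \<longrightarrow>
        (\<exists>!t. t \<in> hom D d d' \<and> (\<forall>i \<in> Obj J. t \<cdot>\<^bsub>D\<^esub> \<gamma> i = \<gamma>' i)))"

text \<open>The comma category \<open>f \<down> c\<close>. Its arrows record their source and target.\<close>

definition comma :: "('o, 'a, 'm) cat_scheme \<Rightarrow> ('p, 'b, 'n) cat_scheme
    \<Rightarrow> ('o, 'a, 'p, 'b, 'k) ftor_scheme \<Rightarrow> 'p
    \<Rightarrow> ('o \<times> 'b, ('o \<times> 'b) \<times> 'a \<times> ('o \<times> 'b)) cat" where
  "comma A C f c =
    \<lparr>Obj = {(x, u). x \<in> Obj A \<and> u \<in> hom C (onObj f x) c},
     Arr = {((x, u), k, (y, v)). x \<in> Obj A \<and> y \<in> Obj A \<and>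
              u \<in> hom C (onObj f x) c \<and> v \<in> hom C (onObj f y) c \<and>
              k \<in> hom A x y \<and> v \<cdot>\<^bsub>C\<^esub> onArr f k = u},
     Src = (\<lambda>(s, k, t). s),
     Trg = (\<lambda>(s, k, t). t),
     Ident = (\<lambda>s. (s, Ident A (fst s), s)),
     Comp = (\<lambda>(s', k', t') (s, k, t). (s, k' \<cdot>\<^bsub>A\<^esub> k, t'))\<rparr>"

definition comma_proj :: "('o \<times> 'b, ('o \<times> 'b) \<times> 'a \<times> ('o \<times> 'b), 'o, 'a) ftor" where
  "comma_proj = \<lparr>onObj = fst, onArr = (\<lambda>(s, k, t). k)\<rparr>"

text \<open>\<open>\<psi> : h \<Rightarrow> l f\<close> exhibits \<open>l : C \<rightarrow> D\<close> as the pointwise left Kan extension of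
  \<open>h : A \<rightarrow> D\<close> along \<open>f : A \<rightarrow> C\<close>: for every \<open>c\<close> the arrows
  \<open>h x \<rightarrow> l (f x) \<rightarrow> l c\<close>, for \<open>u : f x \<rightarrow> c\<close>, form a colimit cocone on \<open>f \<down> c\<close>.\<close>

definition pointwise_lan :: "('o, 'a, 'm) cat_scheme \<Rightarrow> ('p, 'b, 'n) cat_scheme
    \<Rightarrow> ('d, 'e, 'r) cat_scheme \<Rightarrow> ('o, 'a, 'p, 'b, 'k) ftor_scheme
    \<Rightarrow> ('o, 'a, 'd, 'e, 'l) ftor_scheme \<Rightarrow> ('p, 'b, 'd, 'e, 'i) ftor_scheme
    \<Rightarrow> ('o \<Rightarrow> 'e) \<Rightarrow> bool" where
  "pointwise_lan A C D f h l \<psi> \<longleftrightarrow>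
     cat_functor A C f \<and> cat_functor C D l \<and> nat_trans A D h (l \<circ>\<^sub>F f) \<psi> \<and>
     (\<forall>c \<in> Obj C. is_colimit (comma A C f c) D (h \<circ>\<^sub>F comma_proj) (onObj l c)
        (\<lambda>(x, u). onArr l u \<cdot>\<^bsub>D\<^esub> \<psi> x))"

text \<open>Exactness of the lax square \<open>\<phi> : f p \<Rightarrow> g q\<close>, tested against the locally small
  categories with objects in \<open>'d\<close> and arrows in \<open>'e\<close>.\<close>

definition exact_square :: "'k rel \<Rightarrow> 'd itself \<Rightarrow> 'e itself
    \<Rightarrow> ('s, 't, 'm1) cat_scheme \<Rightarrow> ('o, 'a, 'm2) cat_scheme
    \<Rightarrow> ('p, 'b, 'm3) cat_scheme \<Rightarrow> ('q, 'c, 'm4) cat_scheme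
    \<Rightarrow> ('s, 't, 'o, 'a, 'n1) ftor_scheme \<Rightarrow> ('s, 't, 'p, 'b, 'n2) ftor_scheme
    \<Rightarrow> ('o, 'a, 'q, 'c, 'n3) ftor_scheme \<Rightarrow> ('p, 'b, 'q, 'c, 'n4) ftor_scheme
    \<Rightarrow> ('s \<Rightarrow> 'c) \<Rightarrow> bool" where
  "exact_square \<kappa> td te P A B C p q f g \<phi> \<longleftrightarrow>
     (\<forall>(D :: ('d, 'e) cat) (h :: ('o, 'a, 'd, 'e) ftor) (l :: ('q, 'c, 'd, 'e) ftor) \<psi>.
        category D \<longrightarrow> locally_small \<kappa> D \<longrightarrow> pointwise_lan A C D f h l \<psi> \<longrightarrow>
        pointwise_lan P B D q (h \<circ>\<^sub>F p) (l \<circ>\<^sub>F g)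
          (\<lambda>z. onArr l (\<phi> z) \<cdot>\<^bsub>D\<^esub> \<psi> (onObj p z)))"


section \<open>Monoidal categories and colax monoidal functors\<close>

record ('o, 'a) moncat = "('o, 'a) cat" +
  tensObj :: "'o \<Rightarrow> 'o \<Rightarrow> 'o"  (infixr "\<odot>\<index>" 80)
  tensArr :: "'a \<Rightarrow> 'a \<Rightarrow> 'a"  (infixr "\<otimes>\<index>" 80)
  unitObj :: "'o"  ("\<I>\<index>")
  assoc :: "'o \<Rightarrow> 'o \<Rightarrow> 'o \<Rightarrow> 'a"
  lunit :: "'o \<Rightarrow> 'a"
  runit :: "'o \<Rightarrow> 'a"

locale monoidal_category = category V
  for V :: "('o, 'a, 'm) moncat_scheme" (structure) +
  assumes tensObj_closed: "x \<in> Obj V \<Longrightarrow> y \<in> Obj V \<Longrightarrow> x \<odot> y \<in> Obj V"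
    and tensArr_hom: "f \<in> hom V x x' \<Longrightarrow> g \<in> hom V y y'
      \<Longrightarrow> f \<otimes> g \<in> hom V (x \<odot> y) (x' \<odot> y')"
    and tensArr_Ident: "x \<in> Obj V \<Longrightarrow> y \<in> Obj V
      \<Longrightarrow> Ident V x \<otimes> Ident V y = Ident V (x \<odot> y)"
    and interchange: "f \<in> hom V x x' \<Longrightarrow> f' \<in> hom V x' x'' \<Longrightarrow> g \<in> hom V y y' \<Longrightarrow> g' \<in> hom V y' y''
      \<Longrightarrow> (f' \<cdot> f) \<otimes> (g' \<cdot> g) = (f' \<otimes> g') \<cdot> (f \<otimes> g)"
    and unitObj_closed: "\<I> \<in> Obj V"
    and assoc_iso: "x \<in> Obj V \<Longrightarrow> y \<in> Obj V \<Longrightarrow> z \<in> Obj V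
      \<Longrightarrow> iso V ((x \<odot> y) \<odot> z) (x \<odot> (y \<odot> z)) (assoc V x y z)"
    and assoc_natural: "f \<in> hom V x x' \<Longrightarrow> g \<in> hom V y y' \<Longrightarrow> h \<in> hom V z z'
      \<Longrightarrow> assoc V x' y' z' \<cdot> ((f \<otimes> g) \<otimes> h) = (f \<otimes> (g \<otimes> h)) \<cdot> assoc V x y z"
    and lunit_iso: "x \<in> Obj V \<Longrightarrow> iso V (\<I> \<odot> x) x (lunit V x)"
    and lunit_natural: "f \<in> hom V x x'
      \<Longrightarrow> lunit V x' \<cdot> (Ident V \<I> \<otimes> f) = f \<cdot> lunit V x"
    and runit_iso: "x \<in> Obj V \<Longrightarrow> iso V (x \<odot> \<I>) x (runit V x)"
    and runit_natural: "f \<in> hom V x x'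
      \<Longrightarrow> runit V x' \<cdot> (f \<otimes> Ident V \<I>) = f \<cdot> runit V x"
    and pentagon: "w \<in> Obj V \<Longrightarrow> x \<in> Obj V \<Longrightarrow> y \<in> Obj V \<Longrightarrow> z \<in> Obj V
      \<Longrightarrow> (Ident V w \<otimes> assoc V x y z) \<cdot> assoc V w (x \<odot> y) z \<cdot> (assoc V w x y \<otimes> Ident V z)
        = assoc V w x (y \<odot> z) \<cdot> assoc V (w \<odot> x) y z"
    and triangle: "x \<in> Obj V \<Longrightarrow> y \<in> Obj V
      \<Longrightarrow> (Ident V x \<otimes> lunit V y) \<cdot> assoc V x \<I> y = runit V x \<otimes> Ident V y"

record ('o, 'a, 'p, 'b) colax_ftor = "('o, 'a, 'p, 'b) ftor" +
  colax0 :: "'b"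
  colax2 :: "'o \<Rightarrow> 'o \<Rightarrow> 'b"

locale colax_monoidal_functor =
  V: monoidal_category V + W: monoidal_category W + cat_functor V W F
  for V :: "('o, 'a, 'm) moncat_scheme" and W :: "('p, 'b, 'n) moncat_scheme"
    and F :: "('o, 'a, 'p, 'b, 'k) colax_ftor_scheme" +
  assumes colax0_hom: "colax0 F \<in> hom W (onObj F \<I>\<^bsub>V\<^esub>) \<I>\<^bsub>W\<^esub>"
    and colax2_hom: "x \<in> Obj V \<Longrightarrow> y \<in> Obj V
      \<Longrightarrow> colax2 F x y \<in> hom W (onObj F (x \<odot>\<^bsub>V\<^esub> y)) (onObj F x \<odot>\<^bsub>W\<^esub> onObj F y)"
    and colax2_natural: "f \<in> hom V x x' \<Longrightarrow> g \<in> hom V y y'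
      \<Longrightarrow> colax2 F x' y' \<cdot>\<^bsub>W\<^esub> onArr F (f \<otimes>\<^bsub>V\<^esub> g)
        = (onArr F f \<otimes>\<^bsub>W\<^esub> onArr F g) \<cdot>\<^bsub>W\<^esub> colax2 F x y"
    and coassociative: "x \<in> Obj V \<Longrightarrow> y \<in> Obj V \<Longrightarrow> z \<in> Obj V
      \<Longrightarrow> assoc W (onObj F x) (onObj F y) (onObj F z)
            \<cdot>\<^bsub>W\<^esub> (colax2 F x y \<otimes>\<^bsub>W\<^esub> Ident W (onObj F z)) \<cdot>\<^bsub>W\<^esub> colax2 F (x \<odot>\<^bsub>V\<^esub> y) z
        = (Ident W (onObj F x) \<otimes>\<^bsub>W\<^esub> colax2 F y z) \<cdot>\<^bsub>W\<^esub> colax2 F x (y \<odot>\<^bsub>V\<^esub> z)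
            \<cdot>\<^bsub>W\<^esub> onArr F (assoc V x y z)"
    and left_counital: "x \<in> Obj V
      \<Longrightarrow> lunit W (onObj F x) \<cdot>\<^bsub>W\<^esub> (colax0 F \<otimes>\<^bsub>W\<^esub> Ident W (onObj F x)) \<cdot>\<^bsub>W\<^esub> colax2 F \<I>\<^bsub>V\<^esub> x
        = onArr F (lunit V x)"
    and right_counital: "x \<in> Obj V
      \<Longrightarrow> runit W (onObj F x) \<cdot>\<^bsub>W\<^esub> (Ident W (onObj F x) \<otimes>\<^bsub>W\<^esub> colax0 F) \<cdot>\<^bsub>W\<^esub> colax2 F x \<I>\<^bsub>V\<^esub>
        = onArr F (runit V x)"


section \<open>The 2-monad \<open>M\<close> and the colax algebra structure\<close>

definition M_cat :: "('o, 'a, 'm) cat_scheme \<Rightarrow> ('o list, 'a list) cat" where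
  "M_cat C =
    \<lparr>Obj = lists (Obj C),
     Arr = lists (Arr C),
     Src = map (Src C),
     Trg = map (Trg C),
     Ident = map (Ident C),
     Comp = map2 (Comp C)\<rparr>"

definition M_ftor :: "('o, 'a, 'p, 'b, 'k) ftor_scheme \<Rightarrow> ('o list, 'a list, 'p list, 'b list) ftor"
  where
  "M_ftor F = \<lparr>onObj = map (onObj F), onArr = map (onArr F)\<rparr>"

text \<open>The \<open>n\<close>-ary tensor product is bracketed to the right and is strictly normal:
  it is \<open>I\<close> for \<open>n = 0\<close>, the identity for \<open>n = 1\<close> and the given tensor product for \<open>n = 2\<close>.\<close>

fun tensObjs :: "('o, 'a, 'm) moncat_scheme \<Rightarrow> 'o list \<Rightarrow> 'o" where
  "tensObjs V [] = \<I>\<^bsub>V\<^esub>"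
| "tensObjs V [x] = x"
| "tensObjs V (x # y # zs) = x \<odot>\<^bsub>V\<^esub> tensObjs V (y # zs)"

fun tensArrs :: "('o, 'a, 'm) moncat_scheme \<Rightarrow> 'a list \<Rightarrow> 'a" where
  "tensArrs V [] = Ident V \<I>\<^bsub>V\<^esub>"
| "tensArrs V [f] = f"
| "tensArrs V (f # g # hs) = f \<otimes>\<^bsub>V\<^esub> tensArrs V (g # hs)"

definition tensor :: "('o, 'a, 'm) moncat_scheme \<Rightarrow> ('o list, 'a list, 'o, 'a) ftor" where
  "tensor V = \<lparr>onObj = tensObjs V, onArr = tensArrs V\<rparr>"

text \<open>The coherence \<open>F (Z\<^sub>1 \<otimes> \<dots> \<otimes> Z\<^sub>n) \<rightarrow> F Z\<^sub>1 \<otimes> \<dots> \<otimes> F Z\<^sub>n\<close>.\<close>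

fun colax :: "('o, 'a, 'm) moncat_scheme \<Rightarrow> ('p, 'b, 'n) moncat_scheme
    \<Rightarrow> ('o, 'a, 'p, 'b, 'k) colax_ftor_scheme \<Rightarrow> 'o list \<Rightarrow> 'b" where
  "colax V W F [] = colax0 F"
| "colax V W F [x] = Ident W (onObj F x)"
| "colax V W F (x # y # zs) =
     (Ident W (onObj F x) \<otimes>\<^bsub>W\<^esub> colax V W F (y # zs)) \<cdot>\<^bsub>W\<^esub> colax2 F x (tensObjs V (y # zs))"

definition exact_colax :: "'k rel \<Rightarrow> 'd itself \<Rightarrow> 'e itself
    \<Rightarrow> ('o, 'a, 'm) moncat_scheme \<Rightarrow> ('p, 'b, 'n) moncat_scheme
    \<Rightarrow> ('o, 'a, 'p, 'b, 'l) colax_ftor_scheme \<Rightarrow> bool" where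
  "exact_colax \<kappa> td te V W F \<longleftrightarrow>
     exact_square \<kappa> td te (M_cat V) V (M_cat W) W
       (tensor V) (M_ftor F) F (tensor W) (colax V W F)"


section \<open>The category of factorisations\<close>

definition Fact_Obj :: "('o, 'a, 'm) moncat_scheme \<Rightarrow> ('p, 'b, 'n) moncat_scheme
    \<Rightarrow> ('o, 'a, 'p, 'b, 'k) colax_ftor_scheme \<Rightarrow> 'o \<Rightarrow> 'b \<Rightarrow> 'p \<Rightarrow> 'p
    \<Rightarrow> ('a \<times> 'o \<times> 'o \<times> 'b \<times> 'b) set" where
  "Fact_Obj V W F X f Y\<^sub>1 Y\<^sub>2 = {(g, Z\<^sub>1, Z\<^sub>2, h\<^sub>1, h\<^sub>2).
     Z\<^sub>1 \<in> Obj V \<and> Z\<^sub>2 \<in> Obj V \<and> g \<in> hom V X (Z\<^sub>1 \<odot>\<^bsub>V\<^esub> Z\<^sub>2) \<and>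
     h\<^sub>1 \<in> hom W (onObj F Z\<^sub>1) Y\<^sub>1 \<and> h\<^sub>2 \<in> hom W (onObj F Z\<^sub>2) Y\<^sub>2 \<and>
     (h\<^sub>1 \<otimes>\<^bsub>W\<^esub> h\<^sub>2) \<cdot>\<^bsub>W\<^esub> colax2 F Z\<^sub>1 Z\<^sub>2 \<cdot>\<^bsub>W\<^esub> onArr F g = f}"

definition Fact :: "('o, 'a, 'm) moncat_scheme \<Rightarrow> ('p, 'b, 'n) moncat_scheme
    \<Rightarrow> ('o, 'a, 'p, 'b, 'k) colax_ftor_scheme \<Rightarrow> 'o \<Rightarrow> 'b \<Rightarrow> 'p \<Rightarrow> 'p
    \<Rightarrow> ('a \<times> 'o \<times> 'o \<times> 'b \<times> 'b,
        ('a \<times> 'o \<times> 'o \<times> 'b \<times> 'b) \<times> ('a \<times> 'a) \<times> ('a \<times> 'o \<times> 'o \<times> 'b \<times> 'b)) cat" where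
  "Fact V W F X f Y\<^sub>1 Y\<^sub>2 =
    \<lparr>Obj = Fact_Obj V W F X f Y\<^sub>1 Y\<^sub>2,
     Arr = {((g, Z\<^sub>1, Z\<^sub>2, h\<^sub>1, h\<^sub>2), (k\<^sub>1, k\<^sub>2), (g', Z\<^sub>1', Z\<^sub>2', h\<^sub>1', h\<^sub>2')).
       (g, Z\<^sub>1, Z\<^sub>2, h\<^sub>1, h\<^sub>2) \<in> Fact_Obj V W F X f Y\<^sub>1 Y\<^sub>2 \<and>
       (g', Z\<^sub>1', Z\<^sub>2', h\<^sub>1', h\<^sub>2') \<in> Fact_Obj V W F X f Y\<^sub>1 Y\<^sub>2 \<and>
       k\<^sub>1 \<in> hom V Z\<^sub>1 Z\<^sub>1' \<and> k\<^sub>2 \<in> hom V Z\<^sub>2 Z\<^sub>2' \<and>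
       (k\<^sub>1 \<otimes>\<^bsub>V\<^esub> k\<^sub>2) \<cdot>\<^bsub>V\<^esub> g = g' \<and>
       h\<^sub>1 = h\<^sub>1' \<cdot>\<^bsub>W\<^esub> onArr F k\<^sub>1 \<and> h\<^sub>2 = h\<^sub>2' \<cdot>\<^bsub>W\<^esub> onArr F k\<^sub>2},
     Src = (\<lambda>(s, k, t). s),
     Trg = (\<lambda>(s, k, t). t),
     Ident = (\<lambda>(g, Z\<^sub>1, Z\<^sub>2, h\<^sub>1, h\<^sub>2).
       ((g, Z\<^sub>1, Z\<^sub>2, h\<^sub>1, h\<^sub>2), (Ident V Z\<^sub>1, Ident V Z\<^sub>2), (g, Z\<^sub>1, Z\<^sub>2, h\<^sub>1, h\<^sub>2))),
     Comp = (\<lambda>(s', (k\<^sub>1', k\<^sub>2'), t') (s, (k\<^sub>1, k\<^sub>2), t). (s, (k\<^sub>1' \<cdot>\<^bsub>V\<^esub> k\<^sub>1, k\<^sub>2' \<cdot>\<^bsub>V\<^esub> k\<^sub>2), t'))\<rparr>"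

end

theory Submission
  imports Defs
begin

text \<open>A lax square is exact iff for all \<open>\<gamma> : f a \<rightarrow> g b\<close> the factorisations
  \<open>f a \<rightarrow> f (p x) \<rightarrow> g (q x) \<rightarrow> g b\<close> of \<open>\<gamma>\<close> form a connected category. If they do, the functor
  \<open>q \<down> b \<rightarrow> f \<down> g b\<close> induced by \<open>\<phi>\<close> is final, so it preserves the colimits that define a
  pointwise extension. Conversely \<open>hom(f a, -)\<close> is the pointwise extension of \<open>hom(a, -)\<close>
  along \<open>f\<close>, and a colimit of sets is a quotient by zigzags.

  For a colax monoidal functor the factorisations through a list of length \<open>n\<close> are condition (1)
  if \<open>n = 0\<close>, always connected if \<open>n = 1\<close> (compare with the factorisation through the identity),
  and \<open>Fact\<close> if \<open>n = 2\<close>. For larger \<open>n\<close> one splits \<open>Y\<^sub>1 \<otimes> (Y\<^sub>2 \<otimes> \<dots> \<otimes> Y\<^sub>n)\<close>: factor in two first, then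
  factor the second part. Coassociativity and counitality of \<open>F\<close> play no role.\<close>

section \<open>Cocones and connectedness\<close>

text \<open>Why connected factorisations are the right condition: for \<open>D\<close> the category
  of sets and \<open>l\<close> = hom(f a, -), exactness at \<open>b\<close> says that the triples
  \<open>(x, \<alpha>, \<beta>)\<close> modulo zigzags correspond, by composition, bijectively to
  hom(f a, g b). Surjectivity means that every \<gamma> has a factorisation, injectivity that its
  factorisations are connected. The obstacle is size. \<open>D\<close> must be locally small with
  objects in \<open>'d\<close> and arrows in \<open>'e\<close>, so the category of sets is present
  only as a coded copy whose objects are the small subsets of one type. The set of zigzag classes
  need not be small, since \<open>x\<close> ranges over a possibly large class, and it is never
  formed. The classes are separated by invariant predicates instead, that is by cocones into a
  two-element set; only this set and hom-sets have to be coded.\<close>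

context category
begin

lemma homD: "f \<in> hom C x y \<Longrightarrow> f \<in> Arr C \<and> Src C f = x \<and> Trg C f = y \<and> x \<in> Obj C \<and> y \<in> Obj C"
  using Src_closed Trg_closed by (auto simp: hom_def)

lemma Arr_hom: "f \<in> Arr C \<Longrightarrow> f \<in> hom C (Src C f) (Trg C f)"
  by (simp add: hom_def)

text \<open>With sources and targets given by equations, the side conditions of composition are
  solved by rewriting. The \<open>hom\<close> forms would leave the intermediate objects to be
  guessed.\<close>

lemma Comp_Arr:
  assumes "f \<in> Arr C" "g \<in> Arr C" "Trg C f = Src C g"
  shows Arr_Comp: "g \<cdot> f \<in> Arr C" and Src_Comp: "Src C (g \<cdot> f) = Src C f"
    and Trg_Comp: "Trg C (g \<cdot> f) = Trg C g"
  using Comp_hom[of f "Src C f" "Trg C f" g "Trg C g"] assms by (auto simp: hom_def)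

lemma Ident_Arr:
  assumes "x \<in> Obj C"
  shows Arr_Ident: "Ident C x \<in> Arr C" and Src_Ident: "Src C (Ident C x) = x"
    and Trg_Ident: "Trg C (Ident C x) = x"
  using Ident_hom[OF assms] by (auto simp: hom_def)

lemma Comp_assoc_Arr:
  "f \<in> Arr C \<Longrightarrow> g \<in> Arr C \<Longrightarrow> h \<in> Arr C \<Longrightarrow> Trg C f = Src C g \<Longrightarrow> Trg C g = Src C h
    \<Longrightarrow> (h \<cdot> g) \<cdot> f = h \<cdot> (g \<cdot> f)"
  using Comp_assoc[of f "Src C f" "Src C g" g "Src C h" h "Trg C h"] by (auto simp: hom_def)

lemma Comp_Ident_Arr: "f \<in> Arr C \<Longrightarrow> x = Src C f \<Longrightarrow> f \<cdot> Ident C x = f"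
  using Comp_Ident Arr_hom by blast

lemma Ident_Comp_Arr: "f \<in> Arr C \<Longrightarrow> x = Trg C f \<Longrightarrow> Ident C x \<cdot> f = f"
  using Ident_Comp Arr_hom by blast

lemmas Arr_simps = Src_closed Trg_closed Comp_Arr Ident_Arr Comp_assoc_Arr
  Comp_Ident_Arr Ident_Comp_Arr

end

context cat_functor
begin

lemma onArr_Arr:
  assumes "f \<in> Arr A"
  shows Arr_onArr: "onArr F f \<in> Arr B" and Src_onArr: "Src B (onArr F f) = onObj F (Src A f)"
    and Trg_onArr: "Trg B (onArr F f) = onObj F (Trg A f)"
  using onArr_hom[of f "Src A f" "Trg A f"] assms by (auto simp: hom_def)

lemma onArr_Comp_Arr: "f \<in> Arr A \<Longrightarrow> g \<in> Arr A \<Longrightarrow> Trg A f = Src A g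
    \<Longrightarrow> onArr F (g \<cdot>\<^bsub>A\<^esub> f) = onArr F g \<cdot>\<^bsub>B\<^esub> onArr F f"
  using onArr_Comp[of f "Src A f" "Src A g" g "Trg A g"] by (auto simp: hom_def)

lemmas ftor_simps = onObj_closed onArr_Arr onArr_Comp_Arr onArr_Ident

end

lemma fcomp_simps [simp]:
  "onObj (G \<circ>\<^sub>F F) x = onObj G (onObj F x)" "onArr (G \<circ>\<^sub>F F) k = onArr G (onArr F k)"
  by (simp_all add: fcomp_def)

lemma cat_functor_fcomp:
  assumes "cat_functor A B F" and "cat_functor B C G"
  shows "cat_functor A C (G \<circ>\<^sub>F F)"
proof -
  interpret F: cat_functor A B F by fact
  interpret G: cat_functor B C G by fact
  show ?thesis
    by unfold_locales (auto simp: hom_def F.ftor_simps G.ftor_simps)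
qed

lemma comma_simps [simp]:
  "Obj (comma A C f c) = {(x, u). x \<in> Obj A \<and> u \<in> hom C (onObj f x) c}"
  "onObj comma_proj s = fst s" "onArr comma_proj (s, k, t) = k"
  by (simp_all add: comma_def comma_proj_def)

lemma hom_comma:
  "hom (comma A C f c) (x, u) (y, v) = {((x, u), k, (y, v)) | k. x \<in> Obj A \<and> y \<in> Obj A \<and>
     u \<in> hom C (onObj f x) c \<and> v \<in> hom C (onObj f y) c \<and> k \<in> hom A x y \<and> v \<cdot>\<^bsub>C\<^esub> onArr f k = u}"
  by (auto simp: hom_def comma_def)

text \<open>An arrow into \<open>(y, v)\<close> is determined by its underlying \<open>k\<close>,
  because its source must be \<open>(x, v \<cdot> f k)\<close>. Hence compatibility can be
  quantified over \<open>k\<close> and \<open>v\<close>.\<close>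

lemma is_cocone_comma:
  "is_cocone (comma A C f c) D (h \<circ>\<^sub>F comma_proj) d \<gamma> \<longleftrightarrow> d \<in> Obj D \<and>
     (\<forall>x \<in> Obj A. \<forall>u \<in> hom C (onObj f x) c. \<gamma> (x, u) \<in> hom D (onObj h x) d) \<and>
     (\<forall>x \<in> Obj A. \<forall>y \<in> Obj A. \<forall>k \<in> hom A x y. \<forall>v \<in> hom C (onObj f y) c.
        v \<cdot>\<^bsub>C\<^esub> onArr f k \<in> hom C (onObj f x) c \<longrightarrow>
        \<gamma> (y, v) \<cdot>\<^bsub>D\<^esub> onArr h k = \<gamma> (x, v \<cdot>\<^bsub>C\<^esub> onArr f k))"
  unfolding is_cocone_def by (auto simp: hom_comma)

text \<open>Naturality of \<psi> alone yields the cocone, so that universality is all that remains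
  to be shown whenever a pointwise extension is established below.\<close>

lemma is_cocone_nat_trans:
  assumes "cat_functor A C f" and "cat_functor C D l" and "nat_trans A D h (l \<circ>\<^sub>F f) \<psi>"
    and "c \<in> Obj C"
  shows "is_cocone (comma A C f c) D (h \<circ>\<^sub>F comma_proj) (onObj l c)
    (\<lambda>(x, u). onArr l u \<cdot>\<^bsub>D\<^esub> \<psi> x)"
proof -
  interpret f: cat_functor A C f by fact
  interpret l: cat_functor C D l by fact
  interpret h: cat_functor A D h using assms(3) by (simp add: nat_trans_def)
  have \<psi>: "\<psi> x \<in> hom D (onObj h x) (onObj l (onObj f x))" if "x \<in> Obj A" for x
    using assms(3) that by (simp add: nat_trans_def)
  have nat: "\<psi> y \<cdot>\<^bsub>D\<^esub> onArr h k = onArr l (onArr f k) \<cdot>\<^bsub>D\<^esub> \<psi> x" if "k \<in> hom A x y" for k x y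
    using assms(3) that by (simp add: nat_trans_def)
  have "(onArr l v \<cdot>\<^bsub>D\<^esub> \<psi> y) \<cdot>\<^bsub>D\<^esub> onArr h k = onArr l (v \<cdot>\<^bsub>C\<^esub> onArr f k) \<cdot>\<^bsub>D\<^esub> \<psi> x"
    if "x \<in> Obj A" "y \<in> Obj A" "k \<in> hom A x y" "v \<in> hom C (onObj f y) c" for x y k v
  proof -
    have "(onArr l v \<cdot>\<^bsub>D\<^esub> \<psi> y) \<cdot>\<^bsub>D\<^esub> onArr h k = onArr l v \<cdot>\<^bsub>D\<^esub> (\<psi> y \<cdot>\<^bsub>D\<^esub> onArr h k)"
      using that \<psi>[of y] by (auto simp: hom_def l.B.Arr_simps l.ftor_simps h.ftor_simps)
    then show ?thesis
      using that \<psi>[of x] unfolding nat[OF that(3)]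
      by (auto simp: hom_def l.B.Arr_simps l.ftor_simps h.ftor_simps f.ftor_simps)
  qed
  moreover have "onArr l u \<cdot>\<^bsub>D\<^esub> \<psi> x \<in> hom D (onObj h x) (onObj l c)"
    if "x \<in> Obj A" "u \<in> hom C (onObj f x) c" for x u
    using that \<psi>[of x] by (auto simp: hom_def l.B.Arr_simps l.ftor_simps)
  ultimately show ?thesis
    using assms(4) by (auto simp: is_cocone_comma l.onObj_closed)
qed

text \<open>Connectedness of a bare directed graph. Only the endpoints of arrows matter for it, so
  factorisations need not be organised into a category with composition.\<close>

definition linked :: "'x set \<Rightarrow> 'x rel \<Rightarrow> bool" where
  "linked X E \<longleftrightarrow> X \<noteq> {} \<and> (\<forall>x \<in> X. \<forall>y \<in> X. (x, y) \<in> (E \<union> E\<inverse>)\<^sup>*)"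

lemma zigzag_invariant:
  assumes "(x, y) \<in> (E \<union> E\<inverse>)\<^sup>*" and "\<And>u v. (u, v) \<in> E \<Longrightarrow> \<Phi> u = \<Phi> v"
  shows "\<Phi> x = \<Phi> y"
  using assms(1) by induction (auto dest: assms(2))

text \<open>The form in which connectedness is consumed: \<Phi> will be an arrow of \<open>D\<close>
  built from a factorisation, a truth value, or the identity.\<close>

lemma linked_invariant:
  assumes "linked X E" and "x \<in> X" and "y \<in> X" and "\<And>u v. (u, v) \<in> E \<Longrightarrow> \<Phi> u = \<Phi> v"
  shows "\<Phi> x = \<Phi> y"
  using assms(1-3) by (intro zigzag_invariant[OF _ assms(4)]) (auto simp: linked_def)

lemma linked_map:
  assumes "linked X E" and "X' = m ` X" and "\<And>u v. (u, v) \<in> E \<Longrightarrow> (m u, m v) \<in> E'"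
  shows "linked X' E'"
proof -
  have "(m x, m y) \<in> (E' \<union> E'\<inverse>)\<^sup>*" if "(x, y) \<in> (E \<union> E\<inverse>)\<^sup>*" for x y
    using that by induction (auto dest: assms(3) intro: rtrancl.rtrancl_into_rtrancl)
  with assms(1,2) show ?thesis
    by (auto simp: linked_def)
qed

lemma connected_category_linked:
  "connected_category C \<longleftrightarrow> linked (Obj C) ((\<lambda>k. (Src C k, Trg C k)) ` Arr C)"
  by (simp add: connected_category_def linked_def Let_def)

section \<open>Exactness and connected categories of factorisations\<close>

locale lax_square =
  p: cat_functor P A p + q: cat_functor P B q + f: cat_functor A C f + g: cat_functor B C g
  for P :: "('s, 't, 'm1) cat_scheme" and A :: "('o, 'a, 'm2) cat_scheme"
    and B :: "('p, 'b, 'm3) cat_scheme" and C :: "('q, 'c, 'm4) cat_scheme"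
    and p :: "('s, 't, 'o, 'a, 'n1) ftor_scheme" and q :: "('s, 't, 'p, 'b, 'n2) ftor_scheme"
    and f :: "('o, 'a, 'q, 'c, 'n3) ftor_scheme" and g :: "('p, 'b, 'q, 'c, 'n4) ftor_scheme" +
  fixes \<phi> :: "'s \<Rightarrow> 'c"
  assumes \<phi>_hom: "x \<in> Obj P \<Longrightarrow> \<phi> x \<in> hom C (onObj f (onObj p x)) (onObj g (onObj q x))"
    and \<phi>_natural: "k \<in> hom P x y
      \<Longrightarrow> \<phi> y \<cdot>\<^bsub>C\<^esub> onArr f (onArr p k) = onArr g (onArr q k) \<cdot>\<^bsub>C\<^esub> \<phi> x"
begin

definition composite :: "'s \<times> 'a \<times> 'b \<Rightarrow> 'c" where
  "composite = (\<lambda>(x, \<alpha>, \<beta>). onArr g \<beta> \<cdot>\<^bsub>C\<^esub> (\<phi> x \<cdot>\<^bsub>C\<^esub> onArr f \<alpha>))"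

definition facs :: "'o \<Rightarrow> 'p \<Rightarrow> 'c \<Rightarrow> ('s \<times> 'a \<times> 'b) set" where
  "facs a b \<gamma> = {(x, \<alpha>, \<beta>). x \<in> Obj P \<and> \<alpha> \<in> hom A a (onObj p x) \<and> \<beta> \<in> hom B (onObj q x) b \<and>
     composite (x, \<alpha>, \<beta>) = \<gamma>}"

text \<open>With all \<gamma> taken together, the triples modulo these edges are the coend over
  \<open>x\<close> of \<open>hom(a, p x) \<times> hom(q x, b)\<close>; an edge slides
  \<open>k\<close> from the \<beta> side to the \<alpha> side.\<close>

definition fac_edges :: "'o \<Rightarrow> 'p \<Rightarrow> 'c \<Rightarrow> ('s \<times> 'a \<times> 'b) rel" where
  "fac_edges a b \<gamma> = {((x, \<alpha>, \<beta>), (x', \<alpha>', \<beta>')).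
     (x, \<alpha>, \<beta>) \<in> facs a b \<gamma> \<and> (x', \<alpha>', \<beta>') \<in> facs a b \<gamma> \<and>
     (\<exists>k \<in> hom P x x'. onArr p k \<cdot>\<^bsub>A\<^esub> \<alpha> = \<alpha>' \<and> \<beta>' \<cdot>\<^bsub>B\<^esub> onArr q k = \<beta>)}"

lemma composite_hom:
  assumes "x \<in> Obj P" and "\<alpha> \<in> hom A a (onObj p x)" and "\<beta> \<in> hom B (onObj q x) b"
  shows "composite (x, \<alpha>, \<beta>) \<in> hom C (onObj f a) (onObj g b)"
  using assms \<phi>_hom[of x]
  by (auto simp: composite_def hom_def f.B.Arr_simps f.ftor_simps g.ftor_simps)

lemma composite_precomp:
  assumes "x \<in> Obj P" and "\<alpha> \<in> hom A a (onObj p x)" and "\<beta> \<in> hom B (onObj q x) b"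
    and "k \<in> hom A a' a"
  shows "composite (x, \<alpha> \<cdot>\<^bsub>A\<^esub> k, \<beta>) = composite (x, \<alpha>, \<beta>) \<cdot>\<^bsub>C\<^esub> onArr f k"
  using assms \<phi>_hom[of x]
  by (auto simp: composite_def hom_def f.B.Arr_simps f.ftor_simps g.ftor_simps)

text \<open>This is naturality of \<phi> at \<open>k\<close> with \<alpha> and \<beta> attached. It
  makes \<open>composite\<close> constant under sliding, so zigzags stay among the factorisations of
  one \<gamma>.\<close>

lemma composite_slide:
  assumes "k \<in> hom P x y" and "\<alpha> \<in> hom A a (onObj p x)" and "\<beta> \<in> hom B (onObj q y) b"
  shows "composite (y, onArr p k \<cdot>\<^bsub>A\<^esub> \<alpha>, \<beta>) = composite (x, \<alpha>, \<beta> \<cdot>\<^bsub>B\<^esub> onArr q k)"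
proof -
  note k = p.A.homD[OF assms(1)]
  have "onArr g \<beta> \<cdot>\<^bsub>C\<^esub> ((\<phi> y \<cdot>\<^bsub>C\<^esub> onArr f (onArr p k)) \<cdot>\<^bsub>C\<^esub> onArr f \<alpha>)
      = onArr g \<beta> \<cdot>\<^bsub>C\<^esub> ((onArr g (onArr q k) \<cdot>\<^bsub>C\<^esub> \<phi> x) \<cdot>\<^bsub>C\<^esub> onArr f \<alpha>)"
    by (simp add: \<phi>_natural[OF assms(1)])
  then show ?thesis
    using k assms(2,3) \<phi>_hom[of x] \<phi>_hom[of y]
    by (auto simp: composite_def hom_def f.B.Arr_simps f.ftor_simps g.ftor_simps
        p.ftor_simps q.ftor_simps)
qed

lemma facs_precomp:
  assumes "(x, \<alpha>, \<beta>) \<in> facs a b \<gamma>" and "k \<in> hom A a' a"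
  shows "(x, \<alpha> \<cdot>\<^bsub>A\<^esub> k, \<beta>) \<in> facs a' b (\<gamma> \<cdot>\<^bsub>C\<^esub> onArr f k)"
  using assms composite_precomp[of x \<alpha> a \<beta> b k a'] by (auto simp: facs_def intro: p.B.Comp_hom)

text \<open>By \<open>composite_slide\<close> the target is a factorisation of \<gamma> as soon as
  the source is one.\<close>

lemma fac_edgesI:
  assumes "k \<in> hom P x y" and "(x, \<alpha>, \<beta> \<cdot>\<^bsub>B\<^esub> onArr q k) \<in> facs a b \<gamma>"
    and "\<beta> \<in> hom B (onObj q y) b"
  shows "((x, \<alpha>, \<beta> \<cdot>\<^bsub>B\<^esub> onArr q k), (y, onArr p k \<cdot>\<^bsub>A\<^esub> \<alpha>, \<beta>)) \<in> fac_edges a b \<gamma>"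
proof -
  have "(y, onArr p k \<cdot>\<^bsub>A\<^esub> \<alpha>, \<beta>) \<in> facs a b \<gamma>"
    using assms composite_slide[of k x y \<alpha> a \<beta> b] p.A.homD[OF assms(1)]
    by (auto simp: facs_def intro: p.onArr_hom p.B.Comp_hom)
  then show ?thesis
    using assms by (auto simp: fac_edges_def)
qed

section \<open>Connected factorisations imply exactness\<close>

lemma pasted_nat_trans:
  assumes "category D" and "pointwise_lan A C D f h l \<psi>"
  shows "nat_trans P D (h \<circ>\<^sub>F p) ((l \<circ>\<^sub>F g) \<circ>\<^sub>F q) (\<lambda>z. onArr l (\<phi> z) \<cdot>\<^bsub>D\<^esub> \<psi> (onObj p z))"
proof -
  interpret D: category D by fact
  interpret l: cat_functor C D l using assms(2) by (simp add: pointwise_lan_def)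
  have nt: "nat_trans A D h (l \<circ>\<^sub>F f) \<psi>" using assms(2) by (simp add: pointwise_lan_def)
  interpret h: cat_functor A D h using nt by (simp add: nat_trans_def)
  have \<psi>: "\<psi> x \<in> hom D (onObj h x) (onObj l (onObj f x))" if "x \<in> Obj A" for x
    using nt that by (simp add: nat_trans_def)
  have nat: "\<psi> y \<cdot>\<^bsub>D\<^esub> onArr h k = onArr l (onArr f k) \<cdot>\<^bsub>D\<^esub> \<psi> x" if "k \<in> hom A x y" for k x y
    using nt that by (simp add: nat_trans_def)
  have "(onArr l (\<phi> y) \<cdot>\<^bsub>D\<^esub> \<psi> (onObj p y)) \<cdot>\<^bsub>D\<^esub> onArr h (onArr p k)
      = onArr l (onArr g (onArr q k)) \<cdot>\<^bsub>D\<^esub> (onArr l (\<phi> x) \<cdot>\<^bsub>D\<^esub> \<psi> (onObj p x))"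
    if k: "k \<in> hom P x y" for x y k
  proof -
    note k' = p.A.homD[OF k]
    have pk: "onArr p k \<in> hom A (onObj p x) (onObj p y)" using k by (rule p.onArr_hom)
    note ty = k' \<psi>[of "onObj p x"] \<psi>[of "onObj p y"] \<phi>_hom[of x] \<phi>_hom[of y]
    have "(onArr l (\<phi> y) \<cdot>\<^bsub>D\<^esub> \<psi> (onObj p y)) \<cdot>\<^bsub>D\<^esub> onArr h (onArr p k)
        = onArr l (\<phi> y) \<cdot>\<^bsub>D\<^esub> (\<psi> (onObj p y) \<cdot>\<^bsub>D\<^esub> onArr h (onArr p k))"
      using ty by (auto simp: hom_def D.Arr_simps l.ftor_simps h.ftor_simps p.ftor_simps)
    also have "\<dots> = onArr l (\<phi> y \<cdot>\<^bsub>C\<^esub> onArr f (onArr p k)) \<cdot>\<^bsub>D\<^esub> \<psi> (onObj p x)"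
      unfolding nat[OF pk] using ty
      by (auto simp: hom_def D.Arr_simps l.ftor_simps h.ftor_simps p.ftor_simps f.ftor_simps)
    also have "\<dots> = onArr l (onArr g (onArr q k)) \<cdot>\<^bsub>D\<^esub> (onArr l (\<phi> x) \<cdot>\<^bsub>D\<^esub> \<psi> (onObj p x))"
      unfolding \<phi>_natural[OF k] using ty
      by (auto simp: hom_def D.Arr_simps l.ftor_simps h.ftor_simps p.ftor_simps
          g.ftor_simps q.ftor_simps)
    finally show ?thesis .
  qed
  moreover have "onArr l (\<phi> x) \<cdot>\<^bsub>D\<^esub> \<psi> (onObj p x)
      \<in> hom D (onObj h (onObj p x)) (onObj l (onObj g (onObj q x)))" if "x \<in> Obj P" for x
    using that \<psi>[of "onObj p x"] \<phi>_hom[of x]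
    by (auto simp: hom_def D.Arr_simps l.ftor_simps p.ftor_simps)
  ultimately show ?thesis
    unfolding nat_trans_def
    using p.cat_functor_axioms q.cat_functor_axioms g.cat_functor_axioms
      h.cat_functor_axioms l.cat_functor_axioms
    by (auto intro!: cat_functor_fcomp)
qed

text \<open>The induced functor sends \<open>(x, \<beta>)\<close> to
  \<open>(p x, g \<beta> \<cdot> \<phi> x)\<close>. Restriction along it is a bijection on cocones
  with a given vertex, because the values of a cocone on \<open>f \<down> g b\<close> are forced by
  those at the image.\<close>

lemma exact_squareI:
  assumes linked: "\<And>a b \<gamma>. a \<in> Obj A \<Longrightarrow> b \<in> Obj B \<Longrightarrow> \<gamma> \<in> hom C (onObj f a) (onObj g b)
    \<Longrightarrow> linked (facs a b \<gamma>) (fac_edges a b \<gamma>)"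
  shows "exact_square \<kappa> TYPE('d) TYPE('e) P A B C p q f g \<phi>"
  unfolding exact_square_def
proof (intro allI impI)
  fix D :: "('d, 'e) cat" and h :: "('o, 'a, 'd, 'e) ftor" and l :: "('q, 'c, 'd, 'e) ftor" and \<psi>
  assume D: "category D" and lan: "pointwise_lan A C D f h l \<psi>"
  interpret D: category D by fact
  interpret l: cat_functor C D l using lan by (simp add: pointwise_lan_def)
  have nt: "nat_trans A D h (l \<circ>\<^sub>F f) \<psi>" using lan by (simp add: pointwise_lan_def)
  interpret h: cat_functor A D h using nt by (simp add: nat_trans_def)
  have \<psi>: "\<psi> x \<in> hom D (onObj h x) (onObj l (onObj f x))" if "x \<in> Obj A" for x
    using nt that by (simp add: nat_trans_def)
  have nat: "\<psi> y \<cdot>\<^bsub>D\<^esub> onArr h k = onArr l (onArr f k) \<cdot>\<^bsub>D\<^esub> \<psi> x" if "k \<in> hom A x y" for k x y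
    using nt that by (simp add: nat_trans_def)
  let ?\<chi> = "\<lambda>z. onArr l (\<phi> z) \<cdot>\<^bsub>D\<^esub> \<psi> (onObj p z)"
  have \<chi>: "nat_trans P D (h \<circ>\<^sub>F p) ((l \<circ>\<^sub>F g) \<circ>\<^sub>F q) ?\<chi>"
    by (rule pasted_nat_trans[OF D lan])
  have lg: "cat_functor B D (l \<circ>\<^sub>F g)"
    by (intro cat_functor_fcomp[of _ C] g.cat_functor_axioms l.cat_functor_axioms)
  have colim: "is_colimit (comma P B q b) D ((h \<circ>\<^sub>F p) \<circ>\<^sub>F comma_proj) (onObj (l \<circ>\<^sub>F g) b)
      (\<lambda>(x, u). onArr (l \<circ>\<^sub>F g) u \<cdot>\<^bsub>D\<^esub> ?\<chi> x)" if b: "b \<in> Obj B" for b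
    unfolding is_colimit_def
  proof (intro conjI allI impI)
    show "is_cocone (comma P B q b) D ((h \<circ>\<^sub>F p) \<circ>\<^sub>F comma_proj) (onObj (l \<circ>\<^sub>F g) b)
        (\<lambda>(x, u). onArr (l \<circ>\<^sub>F g) u \<cdot>\<^bsub>D\<^esub> ?\<chi> x)"
      by (rule is_cocone_nat_trans[OF q.cat_functor_axioms lg \<chi> b])
    fix d' \<delta>
    assume "is_cocone (comma P B q b) D ((h \<circ>\<^sub>F p) \<circ>\<^sub>F comma_proj) d' \<delta>"
    then have d': "d' \<in> Obj D"
      and \<delta>: "\<And>x u. x \<in> Obj P \<Longrightarrow> u \<in> hom B (onObj q x) b
        \<Longrightarrow> \<delta> (x, u) \<in> hom D (onObj h (onObj p x)) d'"
      and \<delta>_comp: "\<And>x y k v. k \<in> hom P x y \<Longrightarrow> v \<in> hom B (onObj q y) b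
        \<Longrightarrow> \<delta> (y, v) \<cdot>\<^bsub>D\<^esub> onArr h (onArr p k) = \<delta> (x, v \<cdot>\<^bsub>B\<^esub> onArr q k)"
      unfolding is_cocone_comma fcomp_simps
      using p.A.homD q.onArr_hom q.B.Comp_hom by (blast, blast, metis)
    \<comment> \<open>\<open>\<delta>'\<close> extends \<open>\<delta>\<close> along \<open>q \<down> b \<rightarrow> f \<down> g b\<close>; connectedness makes it independent of the
      chosen factorisation.\<close>
    define \<Delta> where "\<Delta> = (\<lambda>(x, \<alpha>, \<beta>). \<delta> (x, \<beta>) \<cdot>\<^bsub>D\<^esub> onArr h \<alpha>)"
    define \<delta>' where "\<delta>' = (\<lambda>(a, u). \<Delta> (SOME z. z \<in> facs a b u))"
    have \<delta>'_eq: "\<delta>' (a, u) = \<Delta> z" if z: "z \<in> facs a b u" and a: "a \<in> Obj A"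
      and u: "u \<in> hom C (onObj f a) (onObj g b)" for a u z
    proof -
      have "\<Delta> (SOME z. z \<in> facs a b u) = \<Delta> z"
      proof (rule linked_invariant[OF linked[OF a b u]])
        show "(SOME z. z \<in> facs a b u) \<in> facs a b u" using z by (rule someI)
        show "z \<in> facs a b u" by fact
        show "\<Delta> s = \<Delta> t" if st: "(s, t) \<in> fac_edges a b u" for s t
        proof -
          obtain x \<alpha> \<beta> x' \<beta>' k where s: "s = (x, \<alpha>, \<beta>)" and t: "t = (x', onArr p k \<cdot>\<^bsub>A\<^esub> \<alpha>, \<beta>')"
            and sf: "s \<in> facs a b u" and tf: "t \<in> facs a b u" and k: "k \<in> hom P x x'"
            and e: "\<beta>' \<cdot>\<^bsub>B\<^esub> onArr q k = \<beta>"
            using st unfolding fac_edges_def by fast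
          have \<beta>': "\<beta>' \<in> hom B (onObj q x') b" and \<alpha>: "\<alpha> \<in> hom A a (onObj p x)"
            using sf tf by (auto simp: facs_def s t)
          have "\<Delta> s = (\<delta> (x', \<beta>') \<cdot>\<^bsub>D\<^esub> onArr h (onArr p k)) \<cdot>\<^bsub>D\<^esub> onArr h \<alpha>"
            using \<delta>_comp[OF k \<beta>'] by (simp add: s \<Delta>_def e)
          also have "\<dots> = \<Delta> t"
            using \<alpha> \<delta>[of x' \<beta>'] \<beta>' p.A.homD[OF k]
            by (auto simp: t \<Delta>_def hom_def D.Arr_simps h.ftor_simps p.ftor_simps)
          finally show ?thesis .
        qed
      qed
      then show ?thesis by (simp add: \<delta>'_def)
    qed
    have ex: "\<exists>x \<alpha> \<beta>. (x, \<alpha>, \<beta>) \<in> facs a b u" if "a \<in> Obj A"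
      and "u \<in> hom C (onObj f a) (onObj g b)" for a u
      using linked[OF that(1) b that(2)] by (auto simp: linked_def)
    have gb: "onObj g b \<in> Obj C" using b by (rule g.onObj_closed)
    have "is_cocone (comma A C f (onObj g b)) D (h \<circ>\<^sub>F comma_proj) d' \<delta>'"
      unfolding is_cocone_comma
    proof (intro conjI ballI impI d')
      fix a u assume a: "a \<in> Obj A" and u: "u \<in> hom C (onObj f a) (onObj g b)"
      then obtain x \<alpha> \<beta> where z: "(x, \<alpha>, \<beta>) \<in> facs a b u" using ex by blast
      then show "\<delta>' (a, u) \<in> hom D (onObj h a) d'"
        using \<delta>[of x \<beta>] unfolding \<delta>'_eq[OF z a u]
        by (auto simp: \<Delta>_def facs_def intro!: D.Comp_hom intro: h.onArr_hom)
    next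
      fix a a' k u assume a: "a \<in> Obj A" "a' \<in> Obj A" and k: "k \<in> hom A a a'"
        and u: "u \<in> hom C (onObj f a') (onObj g b)"
        and u': "u \<cdot>\<^bsub>C\<^esub> onArr f k \<in> hom C (onObj f a) (onObj g b)"
      from a u obtain x \<alpha> \<beta> where z: "(x, \<alpha>, \<beta>) \<in> facs a' b u" using ex by blast
      \<comment> \<open>Precomposing the chosen factorisation with \<open>k\<close> gives one of the
        composite with the same \<open>x\<close> and \<beta>. Independence of the choice allows both
        values of \<delta>' to be computed from this pair.\<close>
      note z' = facs_precomp[OF z k]
      show "\<delta>' (a', u) \<cdot>\<^bsub>D\<^esub> onArr h k = \<delta>' (a, u \<cdot>\<^bsub>C\<^esub> onArr f k)"
        using \<delta>[of x \<beta>] z k unfolding \<delta>'_eq[OF z a(2) u] \<delta>'_eq[OF z' a(1) u']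
        by (auto simp: \<Delta>_def facs_def hom_def D.Arr_simps h.ftor_simps)
    qed
    moreover have "is_colimit (comma A C f (onObj g b)) D (h \<circ>\<^sub>F comma_proj) (onObj l (onObj g b))
        (\<lambda>(x, u). onArr l u \<cdot>\<^bsub>D\<^esub> \<psi> x)"
      using lan gb by (simp add: pointwise_lan_def)
    ultimately have "\<exists>!t. t \<in> hom D (onObj l (onObj g b)) d' \<and>
        (\<forall>i \<in> Obj (comma A C f (onObj g b)). t \<cdot>\<^bsub>D\<^esub> (case i of (x, u) \<Rightarrow> onArr l u \<cdot>\<^bsub>D\<^esub> \<psi> x) = \<delta>' i)"
      unfolding is_colimit_def by blast
    \<comment> \<open>An arrow \<open>t\<close> mediates \<delta>' iff it mediates \<delta>, so
      unique existence passes from the first problem to the second.\<close>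
    moreover have "(\<forall>i \<in> Obj (comma A C f (onObj g b)).
          t \<cdot>\<^bsub>D\<^esub> (case i of (x, u) \<Rightarrow> onArr l u \<cdot>\<^bsub>D\<^esub> \<psi> x) = \<delta>' i) \<longleftrightarrow>
        (\<forall>i \<in> Obj (comma P B q b).
          t \<cdot>\<^bsub>D\<^esub> (case i of (x, u) \<Rightarrow> onArr (l \<circ>\<^sub>F g) u \<cdot>\<^bsub>D\<^esub> ?\<chi> x) = \<delta> i)" (is "?L \<longleftrightarrow> ?R")
      if t: "t \<in> hom D (onObj l (onObj g b)) d'" for t
    proof
      assume L: ?L
      have "t \<cdot>\<^bsub>D\<^esub> (onArr l (onArr g \<beta>) \<cdot>\<^bsub>D\<^esub> ?\<chi> x) = \<delta> (x, \<beta>)"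
        if x: "x \<in> Obj P" and \<beta>: "\<beta> \<in> hom B (onObj q x) b" for x \<beta>
      proof -
        have px: "onObj p x \<in> Obj A" using x by (rule p.onObj_closed)
        \<comment> \<open>The image of \<open>(x, \<beta>)\<close> in \<open>f \<down> g b\<close>.
          Its evident factorisation has \<alpha> the identity, and there \<delta>' takes the value
          \<delta>.\<close>
        define u where "u = onArr g \<beta> \<cdot>\<^bsub>C\<^esub> \<phi> x"
        have u: "u \<in> hom C (onObj f (onObj p x)) (onObj g b)"
          unfolding u_def using \<phi>_hom[OF x] g.onArr_hom[OF \<beta>] by (rule f.B.Comp_hom)
        have z: "(x, Ident A (onObj p x), \<beta>) \<in> facs (onObj p x) b u"
          using x \<beta> px \<phi>_hom[OF x]
          by (auto simp: facs_def composite_def u_def hom_def p.B.Arr_simps f.B.Arr_simps f.ftor_simps)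
        have "t \<cdot>\<^bsub>D\<^esub> (onArr l (onArr g \<beta>) \<cdot>\<^bsub>D\<^esub> ?\<chi> x) = t \<cdot>\<^bsub>D\<^esub> (onArr l u \<cdot>\<^bsub>D\<^esub> \<psi> (onObj p x))"
          using \<beta> \<phi>_hom[OF x] \<psi>[OF px]
          by (auto simp: u_def hom_def D.Arr_simps l.ftor_simps g.ftor_simps)
        also have "\<dots> = \<delta>' (onObj p x, u)"
          using L px u by auto
        also have "\<dots> = \<delta> (x, \<beta>)"
          unfolding \<delta>'_eq[OF z px u] using \<delta>[OF x \<beta>] px
          by (auto simp: \<Delta>_def h.onArr_Ident intro: D.Comp_Ident)
        finally show ?thesis .
      qed
      then show ?R by auto
    next
      assume R: ?R
      have "t \<cdot>\<^bsub>D\<^esub> (onArr l u \<cdot>\<^bsub>D\<^esub> \<psi> a) = \<delta>' (a, u)"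
        if a: "a \<in> Obj A" and u: "u \<in> hom C (onObj f a) (onObj g b)" for a u
      proof -
        obtain x \<alpha> \<beta> where z: "(x, \<alpha>, \<beta>) \<in> facs a b u" using ex a u by blast
        then have x: "x \<in> Obj P" and \<alpha>: "\<alpha> \<in> hom A a (onObj p x)" and \<beta>: "\<beta> \<in> hom B (onObj q x) b"
          and ueq: "u = onArr g \<beta> \<cdot>\<^bsub>C\<^esub> (\<phi> x \<cdot>\<^bsub>C\<^esub> onArr f \<alpha>)"
          by (auto simp: facs_def composite_def)
        have px: "onObj p x \<in> Obj A" using x by (rule p.onObj_closed)
        note ty = \<alpha> \<beta> \<phi>_hom[OF x] \<psi>[OF px] \<psi>[OF a] t
        have "t \<cdot>\<^bsub>D\<^esub> (onArr l u \<cdot>\<^bsub>D\<^esub> \<psi> a)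
            = t \<cdot>\<^bsub>D\<^esub> (onArr l (onArr g \<beta>) \<cdot>\<^bsub>D\<^esub> (onArr l (\<phi> x) \<cdot>\<^bsub>D\<^esub> (onArr l (onArr f \<alpha>) \<cdot>\<^bsub>D\<^esub> \<psi> a)))"
          using ty by (auto simp: ueq hom_def D.Arr_simps f.B.Arr_simps l.ftor_simps g.ftor_simps f.ftor_simps)
        \<comment> \<open>Naturality of \<psi> at \<alpha> moves \<alpha> to the outside, where it
          acts through \<open>h\<close>; what precedes it is the leg at
          \<open>(x, \<beta>)\<close>.\<close>
        also have "\<dots> = (t \<cdot>\<^bsub>D\<^esub> (onArr l (onArr g \<beta>) \<cdot>\<^bsub>D\<^esub> ?\<chi> x)) \<cdot>\<^bsub>D\<^esub> onArr h \<alpha>"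
          unfolding nat[OF \<alpha>, symmetric] using ty
          by (auto simp: hom_def D.Arr_simps l.ftor_simps g.ftor_simps h.ftor_simps)
        also have "\<dots> = \<delta>' (a, u)"
          using R x \<beta> unfolding \<delta>'_eq[OF z a u] by (auto simp: \<Delta>_def)
        finally show ?thesis .
      qed
      then show ?L by auto
    qed
    ultimately show "\<exists>!t. t \<in> hom D (onObj (l \<circ>\<^sub>F g) b) d' \<and> (\<forall>i \<in> Obj (comma P B q b).
          t \<cdot>\<^bsub>D\<^esub> (case i of (x, u) \<Rightarrow> onArr (l \<circ>\<^sub>F g) u \<cdot>\<^bsub>D\<^esub> ?\<chi> x) = \<delta> i)"
      unfolding fcomp_simps(1) by (metis (no_types, lifting))
  qed
  then show "pointwise_lan P B D q (h \<circ>\<^sub>F p) (l \<circ>\<^sub>F g) ?\<chi>"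
    using \<chi> lg q.cat_functor_axioms by (simp add: pointwise_lan_def)
qed

end

section \<open>Coded small sets and corepresentable functors\<close>

text \<open>A copy of the category of small subsets of \<open>'s\<close>: \<open>ar X Y u\<close> codes the restriction of \<open>u\<close>
  to \<open>X\<close>.\<close>

locale small_sets = D: category D
  for D :: "('d, 'e) cat" +
  fixes \<kappa> :: "'k rel" and ob :: "'s set \<Rightarrow> 'd" and ar :: "'s set \<Rightarrow> 's set \<Rightarrow> ('s \<Rightarrow> 's) \<Rightarrow> 'e"
  assumes finite_small: "finite (X :: 's set) \<Longrightarrow> |X| <o \<kappa>"
    and Obj_eq: "Obj D = ob ` {X. |X| <o \<kappa>}"
    and hom_eq: "|X| <o \<kappa> \<Longrightarrow> |Y| <o \<kappa> \<Longrightarrow> hom D (ob X) (ob Y) = ar X Y ` (X \<rightarrow> Y)"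
    and ar_eq_iff: "|X| <o \<kappa> \<Longrightarrow> |Y| <o \<kappa> \<Longrightarrow> u \<in> X \<rightarrow> Y \<Longrightarrow> v \<in> X \<rightarrow> Y
      \<Longrightarrow> ar X Y u = ar X Y v \<longleftrightarrow> (\<forall>x \<in> X. u x = v x)"
    and Comp_ar: "|X| <o \<kappa> \<Longrightarrow> |Y| <o \<kappa> \<Longrightarrow> |Z| <o \<kappa> \<Longrightarrow> u \<in> X \<rightarrow> Y \<Longrightarrow> v \<in> Y \<rightarrow> Z
      \<Longrightarrow> ar Y Z v \<cdot>\<^bsub>D\<^esub> ar X Y u = ar X Z (\<lambda>x. v (u x))"
    and Ident_ar: "|X| <o \<kappa> \<Longrightarrow> Ident D (ob X) = ar X X (\<lambda>x. x)"

text \<open>The two injections supply names for small sets and for functions between them, and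
  \<open>D\<close> consists of exactly these names, decoded by \<open>inv_into\<close>. An arrow's
  name includes domain and codomain, which an extensional function alone does not determine.\<close>

lemma accommodates_Set_small_sets:
  assumes "accommodates_Set \<kappa> TYPE('s) TYPE('d) TYPE('e)"
  shows "\<exists>(D :: ('d, 'e) cat) ob (ar :: 's set \<Rightarrow> _). small_sets D \<kappa> ob ar \<and> locally_small \<kappa> D"
proof -
  define S where "S = {X :: 's set. |X| <o \<kappa>}"
  define T where "T = {(X, Y, u). X \<in> S \<and> Y \<in> S \<and> u \<in> (X :: 's set) \<rightarrow>\<^sub>E (Y :: 's set)}"
  from assms obtain ob :: "'s set \<Rightarrow> 'd" and ar0 :: "'s set \<times> 's set \<times> ('s \<Rightarrow> 's) \<Rightarrow> 'e"
    where \<kappa>: "Card_order \<kappa>" "infinite (Field \<kappa>)"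
      and funs: "\<And>X Y :: 's set. X \<in> S \<Longrightarrow> Y \<in> S \<Longrightarrow> |X \<rightarrow>\<^sub>E Y| <o \<kappa>"
      and ob: "inj_on ob S" and ar0: "inj_on ar0 T"
    unfolding accommodates_Set_def S_def T_def by auto
  define ar where "ar = (\<lambda>X Y u. ar0 (X, Y, restrict u X))"
  define D where "D = \<lparr>Obj = ob ` S, Arr = ar0 ` T,
    Src = (\<lambda>e. ob (fst (inv_into T ar0 e))),
    Trg = (\<lambda>e. ob (fst (snd (inv_into T ar0 e)))),
    Ident = (\<lambda>d. let X = inv_into S ob d in ar X X (\<lambda>x. x)),
    Comp = (\<lambda>e' e. case inv_into T ar0 e' of (Y, Z, v) \<Rightarrow> case inv_into T ar0 e of (X, _, u) \<Rightarrow>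
      ar X Z (\<lambda>x. v (u x)))\<rparr>"
  have T: "(X, Y, restrict u X) \<in> T" if "X \<in> S" "Y \<in> S" "u \<in> X \<rightarrow> Y" for X Y u
    using that by (auto simp: T_def)
  have inv_ar: "inv_into T ar0 (ar X Y u) = (X, Y, restrict u X)"
    if "X \<in> S" "Y \<in> S" "u \<in> X \<rightarrow> Y" for X Y u
    unfolding ar_def using T[OF that] ar0 by (rule inv_into_f_f[rotated])
  have Obj_D: "Obj D = ob ` S"
    by (simp add: D_def)
  have ar_Arr: "ar X Y u \<in> Arr D" "Src D (ar X Y u) = ob X" "Trg D (ar X Y u) = ob Y"
    if "X \<in> S" "Y \<in> S" "u \<in> X \<rightarrow> Y" for X Y u
    using T[OF that] inv_ar[OF that] by (auto simp: D_def ar_def)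
  have Arr_ar: "\<exists>X \<in> S. \<exists>Y \<in> S. \<exists>u \<in> X \<rightarrow> Y. e = ar X Y u" if "e \<in> Arr D" for e
  proof -
    from that obtain X Y u where "X \<in> S" "Y \<in> S" "u \<in> X \<rightarrow>\<^sub>E Y" "e = ar0 (X, Y, u)"
      by (auto simp: D_def T_def)
    then show ?thesis
      by (intro bexI[of _ X] bexI[of _ Y] bexI[of _ u]) (auto simp: ar_def PiE_restrict)
  qed
  have hom_eq: "hom D (ob X) (ob Y) = ar X Y ` (X \<rightarrow> Y)" if "X \<in> S" "Y \<in> S" for X Y
  proof
    show "hom D (ob X) (ob Y) \<subseteq> ar X Y ` (X \<rightarrow> Y)"
    proof
      fix e assume e: "e \<in> hom D (ob X) (ob Y)"
      then obtain X' Y' u where *: "X' \<in> S" "Y' \<in> S" "u \<in> X' \<rightarrow> Y'" "e = ar X' Y' u"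
        using Arr_ar unfolding hom_def by blast
      then have "X' = X" "Y' = Y"
        using e ar_Arr[OF *(1-3)] that inj_onD[OF ob] by (auto simp: hom_def)
      with * show "e \<in> ar X Y ` (X \<rightarrow> Y)" by blast
    qed
    show "ar X Y ` (X \<rightarrow> Y) \<subseteq> hom D (ob X) (ob Y)"
      using ar_Arr that by (auto simp: hom_def)
  qed
  have ar_eq_iff: "ar X Y u = ar X Y v \<longleftrightarrow> (\<forall>x \<in> X. u x = v x)"
    if "X \<in> S" "Y \<in> S" "u \<in> X \<rightarrow> Y" "v \<in> X \<rightarrow> Y" for X Y u v
  proof
    assume "ar X Y u = ar X Y v"
    then have "restrict u X = restrict v X"
      using inv_ar[OF that(1-3)] inv_ar[OF that(1,2,4)] by simp
    then show "\<forall>x \<in> X. u x = v x" by (metis restrict_apply')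
  next
    assume "\<forall>x \<in> X. u x = v x"
    then have "restrict u X = restrict v X" by (intro restrict_ext) auto
    then show "ar X Y u = ar X Y v" by (simp add: ar_def)
  qed
  have Comp_ar: "ar Y Z v \<cdot>\<^bsub>D\<^esub> ar X Y u = ar X Z (\<lambda>x. v (u x))"
    if "X \<in> S" "Y \<in> S" "Z \<in> S" "u \<in> X \<rightarrow> Y" "v \<in> Y \<rightarrow> Z" for X Y Z u v
  proof -
    have "ar Y Z v \<cdot>\<^bsub>D\<^esub> ar X Y u = ar X Z (\<lambda>x. restrict v Y (restrict u X x))"
      by (simp only: D_def cat.select_convs inv_ar[OF that(1,2,4)] inv_ar[OF that(2,3,5)] prod.case)
    also have "\<dots> = ar X Z (\<lambda>x. v (u x))"
      using that by (subst ar_eq_iff) auto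
    finally show ?thesis .
  qed
  have Ident_ar: "Ident D (ob X) = ar X X (\<lambda>x. x)" if "X \<in> S" for X
    using that ob by (simp add: D_def)
  have small: "locally_small \<kappa> D"
    unfolding locally_small_def
  proof (intro ballI)
    fix x y assume "x \<in> Obj D" "y \<in> Obj D"
    then obtain X Y where XY: "X \<in> S" "Y \<in> S" "x = ob X" "y = ob Y"
      by (auto simp: Obj_D)
    have "ar X Y ` (X \<rightarrow> Y) \<subseteq> (\<lambda>u. ar0 (X, Y, u)) ` (X \<rightarrow>\<^sub>E Y)"
      by (auto simp: ar_def)
    then have "|hom D x y| \<le>o |X \<rightarrow>\<^sub>E Y|"
      unfolding XY(3,4) hom_eq[OF XY(1,2)] by (rule ordLeq_transitive[OF card_of_mono1 card_of_image])
    then show "|hom D x y| <o \<kappa>"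
      using funs[OF XY(1,2)] by (rule ordLeq_ordLess_trans)
  qed
  interpret small_sets D \<kappa> ob ar
  proof
    show "|X| <o \<kappa>" if "finite X" for X :: "'s set"
      using that \<kappa> by (intro finite_ordLess_infinite) (auto simp: Field_card_of card_order_on_def card_of_well_order_on)
    show "Obj D = ob ` {X. |X| <o \<kappa>}" by (simp add: Obj_D S_def)
  next
    fix e assume "e \<in> Arr D"
    then obtain X Y u where *: "X \<in> S" "Y \<in> S" "u \<in> X \<rightarrow> Y" and e: "e = ar X Y u"
      using Arr_ar by blast
    show "Src D e \<in> Obj D" "Trg D e \<in> Obj D"
      using ar_Arr[OF *] * by (auto simp: e Obj_D)
  next
    fix x assume "x \<in> Obj D"
    then show "Ident D x \<in> hom D x x"
      by (auto simp: Obj_D Ident_ar hom_eq)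
  next
    have ob': "\<exists>X \<in> S. \<exists>Y \<in> S. x = ob X \<and> y = ob Y \<and> (\<exists>u \<in> X \<rightarrow> Y. e = ar X Y u)"
      if e: "e \<in> hom D x y" for e x y
    proof -
      from e obtain X Y u where *: "X \<in> S" "Y \<in> S" "u \<in> X \<rightarrow> Y" "e = ar X Y u"
        using Arr_ar unfolding hom_def by blast
      moreover have "x = ob X" "y = ob Y"
        using e ar_Arr[OF *(1-3)] *(4) by (auto simp: hom_def)
      ultimately show ?thesis by blast
    qed
    \<comment> \<open>Composability is an equation between names of objects; injectivity turns it
      into equality of the sets themselves, as \<open>Comp_ar\<close> requires.\<close>
    have ob_inj: "X = Y" if "ob X = ob Y" "X \<in> S" "Y \<in> S" for X Y
      using that inj_onD[OF ob] by blast
    show "f \<cdot>\<^bsub>D\<^esub> Ident D x = f" if "f \<in> hom D x y" for f x y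
      using ob'[OF that] by (auto simp: Ident_ar Comp_ar)
    show "Ident D y \<cdot>\<^bsub>D\<^esub> f = f" if "f \<in> hom D x y" for f x y
      using ob'[OF that] by (auto simp: Ident_ar Comp_ar)
    show "g \<cdot>\<^bsub>D\<^esub> f \<in> hom D x z" if f: "f \<in> hom D x y" and g: "g \<in> hom D y z" for f g x y z
    proof -
      obtain X Y u where 1: "X \<in> S" "Y \<in> S" "x = ob X" "y = ob Y" "u \<in> X \<rightarrow> Y" "f = ar X Y u"
        using ob'[OF f] by blast
      obtain Y' Z v where 2: "Y' \<in> S" "Z \<in> S" "y = ob Y'" "z = ob Z" "v \<in> Y' \<rightarrow> Z" "g = ar Y' Z v"
        using ob'[OF g] by blast
      have "Y' = Y" using 1 2 ob_inj by metis
      then show ?thesis using 1 2 by (auto simp: Comp_ar hom_eq intro!: imageI)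
    qed
    show "(h \<cdot>\<^bsub>D\<^esub> g) \<cdot>\<^bsub>D\<^esub> f = h \<cdot>\<^bsub>D\<^esub> (g \<cdot>\<^bsub>D\<^esub> f)"
      if f: "f \<in> hom D w x" and g: "g \<in> hom D x y" and h: "h \<in> hom D y z" for f g h w x y z
    proof -
      obtain W X u where 1: "W \<in> S" "X \<in> S" "w = ob W" "x = ob X" "u \<in> W \<rightarrow> X" "f = ar W X u"
        using ob'[OF f] by blast
      obtain X' Y v where 2: "X' \<in> S" "Y \<in> S" "x = ob X'" "y = ob Y" "v \<in> X' \<rightarrow> Y" "g = ar X' Y v"
        using ob'[OF g] by blast
      obtain Y' Z t where 3: "Y' \<in> S" "Z \<in> S" "y = ob Y'" "z = ob Z" "t \<in> Y' \<rightarrow> Z" "h = ar Y' Z t"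
        using ob'[OF h] by blast
      have "X' = X" "Y' = Y" using 1 2 3 ob_inj by metis+
      moreover have "(\<lambda>x. v (u x)) \<in> W \<rightarrow> Y" "(\<lambda>x. t (v x)) \<in> X \<rightarrow> Z"
        using 1 2 3 calculation by auto
      ultimately show ?thesis
        using 1 2 3 by (simp add: Comp_ar)
    qed
  qed (use hom_eq ar_eq_iff Comp_ar Ident_ar in \<open>simp_all add: S_def\<close>)
  show ?thesis
    using small_sets_axioms small by blast
qed

section \<open>Hom functors with values in the coded sets\<close>

context small_sets
begin

text \<open>Hom-sets of \<open>A\<close> are not sets of elements of \<open>'s\<close>. The
  injection \<open>code\<close> moves them there, and \<open>decode\<close> is its left
  inverse.\<close>

definition hom_ftor :: "('o, 'a, 'm) cat_scheme \<Rightarrow> ('a \<Rightarrow> 's) \<Rightarrow> ('s \<Rightarrow> 'a) \<Rightarrow> 'o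
    \<Rightarrow> ('o, 'a, 'd, 'e) ftor" where
  "hom_ftor A code decode a =
    \<lparr>onObj = (\<lambda>y. ob (code ` hom A a y)),
     onArr = (\<lambda>k. ar (code ` hom A a (Src A k)) (code ` hom A a (Trg A k))
       (\<lambda>s. code (k \<cdot>\<^bsub>A\<^esub> decode s)))\<rparr>"

lemma onObj_hom_ftor: "onObj (hom_ftor A code decode a) y = ob (code ` hom A a y)"
  by (simp add: hom_ftor_def)

lemma onArr_hom_ftor:
  "k \<in> hom A x y \<Longrightarrow> onArr (hom_ftor A code decode a) k
    = ar (code ` hom A a x) (code ` hom A a y) (\<lambda>s. code (k \<cdot>\<^bsub>A\<^esub> decode s))"
  by (simp add: hom_ftor_def hom_def)

lemma small_image: "|X| <o \<kappa> \<Longrightarrow> |code ` X| <o \<kappa>"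
  using card_of_image ordLeq_ordLess_trans by blast

lemma cat_functor_hom_ftor:
  assumes "category A" and small: "locally_small \<kappa> A" and a: "a \<in> Obj A"
    and dc: "\<And>k. decode (code k) = k"
  shows "cat_functor A D (hom_ftor A code decode a)"
proof -
  interpret A: category A by fact
  have sm: "|code ` hom A a x| <o \<kappa>" if "x \<in> Obj A" for x
    using small a that by (auto simp: locally_small_def intro: small_image)
  show ?thesis
  proof
    fix x assume x: "x \<in> Obj A"
    then show "onObj (hom_ftor A code decode a) x \<in> Obj D"
      using sm by (auto simp: onObj_hom_ftor Obj_eq)
    show "onArr (hom_ftor A code decode a) (Ident A x) = Ident D (onObj (hom_ftor A code decode a) x)"
      unfolding onArr_hom_ftor[OF A.Ident_hom[OF x]] onObj_hom_ftor Ident_ar[OF sm[OF x]]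
      using sm[OF x] by (subst ar_eq_iff) (auto simp: dc A.Ident_Comp)
  next
    fix k x y assume k: "k \<in> hom A x y"
    then show "onArr (hom_ftor A code decode a) k
        \<in> hom D (onObj (hom_ftor A code decode a) x) (onObj (hom_ftor A code decode a) y)"
      using sm A.homD[OF k]
      by (auto simp: onArr_hom_ftor[OF k] onObj_hom_ftor hom_eq dc intro!: imageI intro: A.Comp_hom)
  next
    fix k k' x y z assume k: "k \<in> hom A x y" and k': "k' \<in> hom A y z"
    have maps: "(\<lambda>s. code (k \<cdot>\<^bsub>A\<^esub> decode s)) \<in> code ` hom A a x \<rightarrow> code ` hom A a y"
      "(\<lambda>s. code (k' \<cdot>\<^bsub>A\<^esub> decode s)) \<in> code ` hom A a y \<rightarrow> code ` hom A a z"
      "(\<lambda>s. code ((k' \<cdot>\<^bsub>A\<^esub> k) \<cdot>\<^bsub>A\<^esub> decode s)) \<in> code ` hom A a x \<rightarrow> code ` hom A a z"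
      using k k' by (auto simp: dc intro!: imageI A.Comp_hom)
    then have maps': "(\<lambda>s. code (k' \<cdot>\<^bsub>A\<^esub> decode (code (k \<cdot>\<^bsub>A\<^esub> decode s))))
        \<in> code ` hom A a x \<rightarrow> code ` hom A a z"
      by auto
    show "onArr (hom_ftor A code decode a) (k' \<cdot>\<^bsub>A\<^esub> k)
        = onArr (hom_ftor A code decode a) k' \<cdot>\<^bsub>D\<^esub> onArr (hom_ftor A code decode a) k"
      using sm A.homD[OF k] A.homD[OF k'] maps maps' A.Comp_assoc[OF _ k k']
      by (auto simp: onArr_hom_ftor[OF k] onArr_hom_ftor[OF k'] onArr_hom_ftor[OF A.Comp_hom[OF k k']]
          Comp_ar ar_eq_iff dc)
  qed
qed

end

section \<open>Hom functors as pointwise Kan extensions of hom functors\<close>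

locale hom_lan = small_sets D \<kappa> ob ar + f: cat_functor A C f
  for D :: "('d, 'e) cat" and \<kappa> :: "'k rel" and ob :: "('a + 'c) set \<Rightarrow> 'd"
    and ar :: "('a + 'c) set \<Rightarrow> ('a + 'c) set \<Rightarrow> ('a + 'c \<Rightarrow> 'a + 'c) \<Rightarrow> 'e"
    and A :: "('o, 'a, 'm1) cat_scheme" and C :: "('q, 'c, 'm2) cat_scheme"
    and f :: "('o, 'a, 'q, 'c, 'n) ftor_scheme" +
  fixes a :: 'o
  assumes A_small: "locally_small \<kappa> A" and C_small: "locally_small \<kappa> C" and a: "a \<in> Obj A"
begin

text \<open>Here \<open>h\<close> and \<open>l\<close> must land in the same \<open>D\<close>,
  although one has arrows of \<open>A\<close> as elements and the other arrows of \<open>C\<close>.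
  Hence the sum type, with \<open>Inl\<close> tagging the former and \<open>Inr\<close> the
  latter.\<close>

definition h :: "('o, 'a, 'd, 'e) ftor" where
  "h = hom_ftor A Inl projl a"

definition l :: "('q, 'c, 'd, 'e) ftor" where
  "l = hom_ftor C Inr projr (onObj f a)"

definition \<psi> :: "'o \<Rightarrow> 'e" where
  "\<psi> x = ar (Inl ` hom A a x) (Inr ` hom C (onObj f a) (onObj f x)) (\<lambda>s. Inr (onArr f (projl s)))"

lemma small_homs [simp]:
  "x \<in> Obj A \<Longrightarrow> |Inl ` hom A a x :: ('a + 'c) set| <o \<kappa>"
  "c \<in> Obj C \<Longrightarrow> |Inr ` hom C (onObj f a) c :: ('a + 'c) set| <o \<kappa>"
  using A_small C_small a f.onObj_closed[OF a]
  by (auto simp: locally_small_def intro: small_image)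

lemma cat_functor_h: "cat_functor A D h" and cat_functor_l: "cat_functor C D l"
  unfolding h_def l_def
  by (auto intro!: cat_functor_hom_ftor f.A.category_axioms f.B.category_axioms A_small C_small
      f.onObj_closed a)

lemma onObj_h: "onObj h x = ob (Inl ` hom A a x)"
  and onObj_l: "onObj l c = ob (Inr ` hom C (onObj f a) c)"
  and onArr_h: "k \<in> hom A x y \<Longrightarrow>
    onArr h k = ar (Inl ` hom A a x) (Inl ` hom A a y) (\<lambda>s. Inl (k \<cdot>\<^bsub>A\<^esub> projl s))"
  and onArr_l: "u \<in> hom C c c' \<Longrightarrow>
    onArr l u = ar (Inr ` hom C (onObj f a) c) (Inr ` hom C (onObj f a) c') (\<lambda>s. Inr (u \<cdot>\<^bsub>C\<^esub> projr s))"
  by (simp_all add: h_def l_def onObj_hom_ftor onArr_hom_ftor)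

lemma l_\<psi>:
  assumes x: "x \<in> Obj A" and u: "u \<in> hom C (onObj f x) c"
  shows "onArr l u \<cdot>\<^bsub>D\<^esub> \<psi> x = ar (Inl ` hom A a x) (Inr ` hom C (onObj f a) c)
    (\<lambda>s. Inr (u \<cdot>\<^bsub>C\<^esub> onArr f (projl s)))"
  unfolding onArr_l[OF u] \<psi>_def
  using f.B.homD[OF u] x u
  by (subst Comp_ar) (auto intro!: f.onArr_hom f.B.Comp_hom)

text \<open>A cocone with vertex \<open>Y\<close> is a compatible family of maps from hom(a, x) to
  \<open>Y\<close>, indexed by arrows \<open>u\<close> from \<open>f x\<close> to \<open>c\<close>.
  By Yoneda in \<open>x\<close> it amounts to one element of \<open>Y\<close> for each arrow from
  \<open>f a\<close> to \<open>c\<close>, that is to a function on \<open>l c\<close>.\<close>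

lemma pointwise_lan_hom: "pointwise_lan A C D f h l \<psi>"
proof -
  have \<psi>: "\<psi> x \<in> hom D (onObj h x) (onObj l (onObj f x))" if "x \<in> Obj A" for x
    using that f.onObj_closed[OF that]
    by (auto simp: \<psi>_def onObj_h onObj_l hom_eq intro!: imageI f.onArr_hom)
  have nat: "\<psi> y \<cdot>\<^bsub>D\<^esub> onArr h k = onArr l (onArr f k) \<cdot>\<^bsub>D\<^esub> \<psi> x" if k: "k \<in> hom A x y" for k x y
  proof -
    have xy: "x \<in> Obj A" "y \<in> Obj A" and fk: "onArr f k \<in> hom C (onObj f x) (onObj f y)"
      using f.A.homD[OF k] f.onArr_hom[OF k] by auto
    have maps: "(\<lambda>s. Inl (k \<cdot>\<^bsub>A\<^esub> projl s)) \<in> Inl ` hom A a x \<rightarrow> Inl ` hom A a y"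
      "(\<lambda>s. Inr (onArr f (projl s))) \<in> Inl ` hom A a y \<rightarrow> Inr ` hom C (onObj f a) (onObj f y)"
      "(\<lambda>s. Inr (onArr f (k \<cdot>\<^bsub>A\<^esub> projl s))) \<in> Inl ` hom A a x \<rightarrow> Inr ` hom C (onObj f a) (onObj f y)"
      using k by (auto intro!: imageI f.onArr_hom intro: f.A.Comp_hom)
    have "\<psi> y \<cdot>\<^bsub>D\<^esub> onArr h k = ar (Inl ` hom A a x) (Inr ` hom C (onObj f a) (onObj f y))
        (\<lambda>s. Inr (onArr f (k \<cdot>\<^bsub>A\<^esub> projl s)))"
      unfolding \<psi>_def onArr_h[OF k] using xy maps by (subst Comp_ar) (simp_all add: f.onObj_closed)
    also have "\<dots> = onArr l (onArr f k) \<cdot>\<^bsub>D\<^esub> \<psi> x"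
      using xy maps k fk by (auto simp: l_\<psi>[OF _ fk] f.onObj_closed f.onArr_Comp[OF _ k]
          intro!: ar_eq_iff[THEN iffD2] imageI f.B.Comp_hom[OF f.onArr_hom fk])
    finally show ?thesis .
  qed
  have nt: "nat_trans A D h (l \<circ>\<^sub>F f) \<psi>"
    using cat_functor_h cat_functor_l \<psi> nat f.cat_functor_axioms by (auto simp: nat_trans_def intro: cat_functor_fcomp)
  have "is_colimit (comma A C f c) D (h \<circ>\<^sub>F comma_proj) (onObj l c) (\<lambda>(x, u). onArr l u \<cdot>\<^bsub>D\<^esub> \<psi> x)"
    if c: "c \<in> Obj C" for c
    unfolding is_colimit_def
  proof (intro conjI allI impI)
    show "is_cocone (comma A C f c) D (h \<circ>\<^sub>F comma_proj) (onObj l c) (\<lambda>(x, u). onArr l u \<cdot>\<^bsub>D\<^esub> \<psi> x)"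
      by (rule is_cocone_nat_trans[OF f.cat_functor_axioms cat_functor_l nt c])
    fix d' \<delta> assume coc: "is_cocone (comma A C f c) D (h \<circ>\<^sub>F comma_proj) d' \<delta>"
    then obtain Y where Y: "|Y| <o \<kappa>" and d': "d' = ob Y"
      by (auto simp: is_cocone_def Obj_eq)
    \<comment> \<open>Every leg is the code of some function. Choosing these functions once replaces
      equations in \<open>D\<close> by equations between values.\<close>
    have "\<exists>\<delta>0. \<delta>0 \<in> Inl ` hom A a x \<rightarrow> Y \<and> \<delta> (x, u) = ar (Inl ` hom A a x) Y \<delta>0"
      if "x \<in> Obj A" "u \<in> hom C (onObj f x) c" for x u
    proof -
      have "\<delta> (x, u) \<in> hom D (ob (Inl ` hom A a x)) (ob Y)"
        using coc that unfolding is_cocone_comma by (simp add: onObj_h d')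
      then show ?thesis
        using that Y by (auto simp: hom_eq)
    qed
    then obtain \<delta>0 where \<delta>0: "\<And>x u. x \<in> Obj A \<Longrightarrow> u \<in> hom C (onObj f x) c
        \<Longrightarrow> \<delta>0 x u \<in> Inl ` hom A a x \<rightarrow> Y \<and> \<delta> (x, u) = ar (Inl ` hom A a x) Y (\<delta>0 x u)"
      by metis
    have \<delta>0_comp: "\<delta>0 y v (Inl (k \<cdot>\<^bsub>A\<^esub> m)) = \<delta>0 x (v \<cdot>\<^bsub>C\<^esub> onArr f k) (Inl m)"
      if k: "k \<in> hom A x y" and v: "v \<in> hom C (onObj f y) c" and m: "m \<in> hom A a x" for x y k v m
    proof -
      note xy = f.A.homD[OF k]
      have vk: "v \<cdot>\<^bsub>C\<^esub> onArr f k \<in> hom C (onObj f x) c"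
        using f.onArr_hom[OF k] v by (rule f.B.Comp_hom)
      have funs: "\<delta>0 y v \<in> Inl ` hom A a y \<rightarrow> Y" "\<delta>0 x (v \<cdot>\<^bsub>C\<^esub> onArr f k) \<in> Inl ` hom A a x \<rightarrow> Y"
        "(\<lambda>s. Inl (k \<cdot>\<^bsub>A\<^esub> projl s)) \<in> Inl ` hom A a x \<rightarrow> Inl ` hom A a y"
        using \<delta>0 xy v vk k by (auto intro!: f.A.Comp_hom imageI)
      have "ar (Inl ` hom A a y) Y (\<delta>0 y v)
            \<cdot>\<^bsub>D\<^esub> ar (Inl ` hom A a x) (Inl ` hom A a y) (\<lambda>s. Inl (k \<cdot>\<^bsub>A\<^esub> projl s))
          = ar (Inl ` hom A a x) Y (\<delta>0 x (v \<cdot>\<^bsub>C\<^esub> onArr f k))"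
        using coc xy k v vk \<delta>0[of y v] \<delta>0[of x "v \<cdot>\<^bsub>C\<^esub> onArr f k"]
        unfolding is_cocone_comma by (metis onArr_h[OF k])
      then have "\<forall>s \<in> Inl ` hom A a x. \<delta>0 y v (Inl (k \<cdot>\<^bsub>A\<^esub> projl s)) = \<delta>0 x (v \<cdot>\<^bsub>C\<^esub> onArr f k) s"
        using funs xy Y by (subst (asm) Comp_ar; (subst (asm) ar_eq_iff)?) (auto simp: Pi_iff)
      then show ?thesis using m by auto
    qed
    let ?I = "Inl (Ident A a)"
    \<comment> \<open>Yoneda: a cocone is determined by its values at \<open>Ident A a\<close>.\<close>
    define t0 where "t0 = (\<lambda>s :: 'a + 'c. \<delta>0 a (projr s) ?I)"
    have t0: "t0 \<in> Inr ` hom C (onObj f a) c \<rightarrow> Y"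
      using \<delta>0[OF a] f.A.Ident_hom[OF a] unfolding t0_def by fastforce
    \<comment> \<open>Stated for an arbitrary function \<open>t\<close>, so that it serves both
      existence, with \<open>t0\<close>, and uniqueness.\<close>
    have factor: "ar (Inr ` hom C (onObj f a) c) Y t \<cdot>\<^bsub>D\<^esub> (onArr l u \<cdot>\<^bsub>D\<^esub> \<psi> x) = \<delta> (x, u)
        \<longleftrightarrow> (\<forall>m \<in> hom A a x. t (Inr (u \<cdot>\<^bsub>C\<^esub> onArr f m)) = \<delta>0 x u (Inl m))"
      if t: "t \<in> Inr ` hom C (onObj f a) c \<rightarrow> Y" and x: "x \<in> Obj A" and u: "u \<in> hom C (onObj f x) c"
      for t x u
    proof -
      have maps: "(\<lambda>s. Inr (u \<cdot>\<^bsub>C\<^esub> onArr f (projl s)))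
          \<in> Inl ` hom A a x \<rightarrow> Inr ` hom C (onObj f a) c"
        using u by (auto intro!: f.B.Comp_hom f.onArr_hom imageI)
      have maps': "(\<lambda>s. t (Inr (u \<cdot>\<^bsub>C\<^esub> onArr f (projl s)))) \<in> Inl ` hom A a x \<rightarrow> Y"
        by (intro Pi_I funcset_mem[OF t] funcset_mem[OF maps])
      have "ar (Inr ` hom C (onObj f a) c) Y t \<cdot>\<^bsub>D\<^esub> (onArr l u \<cdot>\<^bsub>D\<^esub> \<psi> x)
          = ar (Inl ` hom A a x) Y (\<lambda>s. t (Inr (u \<cdot>\<^bsub>C\<^esub> onArr f (projl s))))"
        unfolding l_\<psi>[OF x u] using t maps x c Y by (subst Comp_ar) simp_all
      then show ?thesis
        using \<delta>0[OF x u] ar_eq_iff[OF small_homs(1)[OF x] Y maps', of "\<delta>0 x u"] by simp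
    qed
    let ?P = "\<lambda>t. t \<in> hom D (onObj l c) d' \<and> (\<forall>i \<in> Obj (comma A C f c).
        t \<cdot>\<^bsub>D\<^esub> (case i of (x, u) \<Rightarrow> onArr l u \<cdot>\<^bsub>D\<^esub> \<psi> x) = \<delta> i)"
    have hom_t: "hom D (onObj l c) d' = ar (Inr ` hom C (onObj f a) c) Y ` (Inr ` hom C (onObj f a) c \<rightarrow> Y)"
      using c Y by (simp add: onObj_l d' hom_eq)
    show "\<exists>!t. ?P t"
    proof (rule ex1I)
      \<comment> \<open>Compatibility along \<open>m\<close>, evaluated at the identity of
        \<open>a\<close>, carries the value at \<open>m\<close> back to the leg indexed by
        \<open>u \<cdot> f m\<close>.\<close>
      have "t0 (Inr (u \<cdot>\<^bsub>C\<^esub> onArr f m)) = \<delta>0 x u (Inl m)"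
        if "x \<in> Obj A" "u \<in> hom C (onObj f x) c" "m \<in> hom A a x" for x u m
        using \<delta>0_comp[OF that(3,2) f.A.Ident_hom[OF a]] that by (simp add: t0_def f.A.Comp_Ident)
      then show "?P (ar (Inr ` hom C (onObj f a) c) Y t0)"
        using t0 factor[OF t0] by (auto simp: hom_t)
      fix t assume t: "?P t"
      then obtain t1 where t1: "t1 \<in> Inr ` hom C (onObj f a) c \<rightarrow> Y"
        and t_eq: "t = ar (Inr ` hom C (onObj f a) c) Y t1"
        by (auto simp: hom_t)
      \<comment> \<open>The leg at \<open>(a, u)\<close> sends the identity of \<open>a\<close> to
        \<open>u\<close> itself, so any mediating function is forced at \<open>u\<close>.\<close>
      have "t1 (Inr u) = t0 (Inr u)" if u: "u \<in> hom C (onObj f a) c" for u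
        using t factor[OF t1 a u] a u f.A.Ident_hom[OF a] f.B.Comp_Ident[OF u]
        by (auto simp: t_eq t0_def f.onArr_Ident)
      then show "t = ar (Inr ` hom C (onObj f a) c) Y t0"
        using t0 t1 c Y by (simp add: t_eq ar_eq_iff)
    qed
  qed
  then show ?thesis
    using f.cat_functor_axioms cat_functor_l nt by (simp add: pointwise_lan_def)
qed

end

section \<open>Exactness implies connected factorisations\<close>

context lax_square
begin

text \<open>Exactness applied to the hom functors makes hom(f a, g b) the colimit over
  \<open>q \<down> b\<close> of the sets hom(a, p x). Uniqueness of mediating arrows gives a
  factorisation of \<gamma>; their existence, for the predicate of being reachable from a fixed
  factorisation, gives connectedness.\<close>

lemma exact_squareD:
  assumes acc: "accommodates_Set \<kappa> TYPE('a + 'c) TYPE('d) TYPE('e)"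
    and A_small: "locally_small \<kappa> A" and C_small: "locally_small \<kappa> C"
    and exact: "exact_square \<kappa> TYPE('d) TYPE('e) P A B C p q f g \<phi>"
    and a: "a \<in> Obj A" and b: "b \<in> Obj B" and \<gamma>: "\<gamma> \<in> hom C (onObj f a) (onObj g b)"
  shows "linked (facs a b \<gamma>) (fac_edges a b \<gamma>)"
proof -
  obtain D :: "('d, 'e) cat" and ob and ar :: "('a + 'c) set \<Rightarrow> _"
    where "small_sets D \<kappa> ob ar" and D_small: "locally_small \<kappa> D"
    using accommodates_Set_small_sets[OF acc] by blast
  then interpret small_sets D \<kappa> ob ar by simp
  interpret hom_lan D \<kappa> ob ar A C f a
    by unfold_locales (fact A_small C_small a)+
  have lan': "pointwise_lan P B D q (h \<circ>\<^sub>F p) (l \<circ>\<^sub>F g) (\<lambda>z. onArr l (\<phi> z) \<cdot>\<^bsub>D\<^esub> \<psi> (onObj p z))"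
    using exact D.category_axioms D_small pointwise_lan_hom unfolding exact_square_def by blast
  let ?H = "Inr ` hom C (onObj f a) (onObj g b) :: ('a + 'c) set"
  let ?A = "\<lambda>x. Inl ` hom A a (onObj p x) :: ('a + 'c) set"
  have gb: "onObj g b \<in> Obj C" using b by (rule g.onObj_closed)
  let ?leg = "\<lambda>(x, u). onArr (l \<circ>\<^sub>F g) u \<cdot>\<^bsub>D\<^esub> (onArr l (\<phi> x) \<cdot>\<^bsub>D\<^esub> \<psi> (onObj p x))"
  have colim: "is_colimit (comma P B q b) D ((h \<circ>\<^sub>F p) \<circ>\<^sub>F comma_proj) (ob ?H) ?leg"
    using lan' b by (auto simp: pointwise_lan_def onObj_l)
  \<comment> \<open>Decoded, the leg at \<open>(x, \<beta>)\<close> sends \<alpha> to the composite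
    of the triple.\<close>
  have leg: "?leg (x, \<beta>) = ar (?A x) ?H (\<lambda>s. Inr (composite (x, projl s, \<beta>)))"
    if x: "x \<in> Obj P" and \<beta>: "\<beta> \<in> hom B (onObj q x) b" for x \<beta>
  proof -
    note px = p.onObj_closed[OF x] and g\<beta> = g.onArr_hom[OF \<beta>]
    have "\<phi> x \<cdot>\<^bsub>C\<^esub> onArr f m \<in> hom C (onObj f a) (onObj g (onObj q x))"
      if "m \<in> hom A a (onObj p x)" for m
      using that \<phi>_hom[OF x] by (auto intro: f.B.Comp_hom f.onArr_hom)
    then show ?thesis
      using x \<beta> px g\<beta> f.B.homD[OF g\<beta>]
      by (auto simp: l_\<psi>[OF px \<phi>_hom[OF x]] onArr_l[OF g\<beta>] composite_def, subst Comp_ar)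
        (auto intro: f.B.Comp_hom)
  qed
  \<comment> \<open>The tags of the sum provide two distinct elements even if \<open>'a\<close> and
    \<open>'c\<close> have only one element each.\<close>
  define tt :: "'a + 'c" where "tt = Inl undefined"
  define ff :: "'a + 'c" where "ff = Inr undefined"
  have tf: "tt \<noteq> ff" by (simp add: tt_def ff_def)
  let ?B = "{tt, ff}"
  have B: "|?B| <o \<kappa>" by (rule finite_small) simp
  \<comment> \<open>Cocones into the two-element set are zigzag-invariant predicates on factorisations of all
    \<open>\<gamma>\<close>; by the universal property they depend only on \<open>\<gamma>\<close>.\<close>
  have classify: "\<exists>!t. t \<in> hom D (ob ?H) (ob ?B) \<and> (\<forall>x \<in> Obj P. \<forall>\<beta> \<in> hom B (onObj q x) b.
      t \<cdot>\<^bsub>D\<^esub> ?leg (x, \<beta>) = ar (?A x) ?B (\<lambda>s. if Q (x, projl s, \<beta>) then tt else ff))"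
    if Q: "\<And>x y k \<alpha> \<beta>. k \<in> hom P x y \<Longrightarrow> \<alpha> \<in> hom A a (onObj p x) \<Longrightarrow> \<beta> \<in> hom B (onObj q y) b
      \<Longrightarrow> Q (y, onArr p k \<cdot>\<^bsub>A\<^esub> \<alpha>, \<beta>) = Q (x, \<alpha>, \<beta> \<cdot>\<^bsub>B\<^esub> onArr q k)" for Q
  proof -
    let ?\<delta> = "\<lambda>(x, \<beta>). ar (?A x) ?B (\<lambda>s. if Q (x, projl s, \<beta>) then tt else ff)"
    have "is_cocone (comma P B q b) D ((h \<circ>\<^sub>F p) \<circ>\<^sub>F comma_proj) (ob ?B) ?\<delta>"
      unfolding is_cocone_comma
    proof (intro conjI ballI impI)
      show "ob ?B \<in> Obj D" using B by (auto simp: Obj_eq)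
      show "?\<delta> (x, u) \<in> hom D (onObj (h \<circ>\<^sub>F p) x) (ob ?B)"
        if "x \<in> Obj P" for x u
        using that B p.onObj_closed[OF that] by (auto simp: onObj_h hom_eq intro!: imageI)
      show "?\<delta> (y, v) \<cdot>\<^bsub>D\<^esub> onArr (h \<circ>\<^sub>F p) k = ?\<delta> (x, v \<cdot>\<^bsub>B\<^esub> onArr q k)"
        if "x \<in> Obj P" "y \<in> Obj P" "k \<in> hom P x y" "v \<in> hom B (onObj q y) b" for x y k v
      proof -
        note pk = p.onArr_hom[OF that(3)]
        have maps: "(\<lambda>s. Inl (onArr p k \<cdot>\<^bsub>A\<^esub> projl s)) \<in> ?A x \<rightarrow> ?A y"
          using pk by (auto intro!: imageI p.B.Comp_hom)
        show ?thesis
          using that B p.onObj_closed maps Q[OF that(3) _ that(4)]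
          by (simp add: onArr_h[OF pk], subst Comp_ar) (auto simp: ar_eq_iff)
      qed
    qed
    then have "\<exists>!t. t \<in> hom D (ob ?H) (ob ?B) \<and>
        (\<forall>i \<in> Obj (comma P B q b). t \<cdot>\<^bsub>D\<^esub> ?leg i = ?\<delta> i)"
      using colim unfolding is_colimit_def by blast
    moreover have "(\<forall>i \<in> Obj (comma P B q b). t \<cdot>\<^bsub>D\<^esub> ?leg i = ?\<delta> i) \<longleftrightarrow>
        (\<forall>x \<in> Obj P. \<forall>\<beta> \<in> hom B (onObj q x) b. t \<cdot>\<^bsub>D\<^esub> ?leg (x, \<beta>) = ?\<delta> (x, \<beta>))" for t
      unfolding comma_simps by blast
    ultimately show ?thesis by simp
  qed
  \<comment> \<open>A mediating arrow is thus a subset of hom(f a, g b) whose inverse image under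
    \<open>composite\<close> is \<open>Q\<close>.\<close>
  have represents: "ar ?H ?B t \<cdot>\<^bsub>D\<^esub> ?leg (x, \<beta>)
        = ar (?A x) ?B (\<lambda>s. if Q (x, projl s, \<beta>) then tt else ff)
      \<longleftrightarrow> (\<forall>\<alpha> \<in> hom A a (onObj p x). t (Inr (composite (x, \<alpha>, \<beta>))) = tt \<longleftrightarrow> Q (x, \<alpha>, \<beta>))"
    if t: "t \<in> ?H \<rightarrow> ?B" and x: "x \<in> Obj P" and \<beta>: "\<beta> \<in> hom B (onObj q x) b" for t x \<beta> Q
  proof -
    have maps: "(\<lambda>s. Inr (composite (x, projl s, \<beta>))) \<in> ?A x \<rightarrow> ?H"
      using composite_hom[OF x _ \<beta>] by auto
    then have maps': "(\<lambda>s. t (Inr (composite (x, projl s, \<beta>)))) \<in> ?A x \<rightarrow> ?B"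
      using t by (auto simp: Pi_iff)
    have "ar ?H ?B t \<cdot>\<^bsub>D\<^esub> ?leg (x, \<beta>) = ar (?A x) ?B (\<lambda>s. t (Inr (composite (x, projl s, \<beta>))))"
      unfolding leg[OF x \<beta>] using t maps x B gb p.onObj_closed by (simp add: Comp_ar)
    then show ?thesis
      using maps' x B p.onObj_closed tf by (simp add: ar_eq_iff) (fastforce simp: Pi_iff)
  qed
  have homH: "hom D (ob ?H) (ob ?B) = ar ?H ?B ` (?H \<rightarrow> ?B)"
    using gb B by (simp add: hom_eq)
  have "facs a b \<gamma> \<noteq> {}"
  proof
    assume empty: "facs a b \<gamma> = {}"
    \<comment> \<open>If \<gamma> is no composite, changing the constant function at \<gamma> is
      invisible to all legs. Both functions then mediate the cocone of the predicate that is always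
      true.\<close>
    let ?s = "\<lambda>z. if z = Inr \<gamma> then ff else tt"
    have maps: "(\<lambda>_. tt) \<in> ?H \<rightarrow> ?B" "?s \<in> ?H \<rightarrow> ?B" by auto
    have ne: "composite (x, \<alpha>, \<beta>) \<noteq> \<gamma>"
      if "x \<in> Obj P" "\<alpha> \<in> hom A a (onObj p x)" "\<beta> \<in> hom B (onObj q x) b" for x \<alpha> \<beta>
      using empty that by (auto simp: facs_def)
    have const: "ar ?H ?B t \<in> hom D (ob ?H) (ob ?B) \<and> (\<forall>x \<in> Obj P. \<forall>\<beta> \<in> hom B (onObj q x) b.
        ar ?H ?B t \<cdot>\<^bsub>D\<^esub> ?leg (x, \<beta>) = ar (?A x) ?B (\<lambda>s. if True then tt else ff))"
      if "t \<in> {\<lambda>_. tt, ?s}" for t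
      using that maps ne represents[of t _ _ "\<lambda>_. True"] by (auto simp: homH)
    have "ar ?H ?B (\<lambda>_. tt) = ar ?H ?B ?s"
      by (rule Uniq_D[OF conjunct2[OF ex1_iff_ex_Uniq[THEN iffD1, OF classify[of "\<lambda>_. True"]]]])
        (rule refl, rule const, simp, rule const, simp)
    then show False
      using \<gamma> gb B maps tf by (auto simp: ar_eq_iff)
  qed
  moreover have "(z0, z1) \<in> (fac_edges a b \<gamma> \<union> (fac_edges a b \<gamma>)\<inverse>)\<^sup>*"
    if z0: "z0 \<in> facs a b \<gamma>" and z1: "z1 \<in> facs a b \<gamma>" for z0 z1
  proof -
    let ?Z = "(fac_edges a b \<gamma> \<union> (fac_edges a b \<gamma>)\<inverse>)\<^sup>*"
    \<comment> \<open>Membership in \<open>facs\<close> is part of \<open>Q\<close> because the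
      predicate must be defined, and invariant, on the triples over every \<gamma>; off the given
      one it is false.\<close>
    define Q where "Q z \<longleftrightarrow> z \<in> facs a b \<gamma> \<and> (z0, z) \<in> ?Z" for z
    have Q: "Q (y, onArr p k \<cdot>\<^bsub>A\<^esub> \<alpha>, \<beta>) = Q (x, \<alpha>, \<beta> \<cdot>\<^bsub>B\<^esub> onArr q k)"
      if k: "k \<in> hom P x y" and \<alpha>: "\<alpha> \<in> hom A a (onObj p x)" and \<beta>: "\<beta> \<in> hom B (onObj q y) b"
      for x y k \<alpha> \<beta>
    proof -
      let ?s = "(x, \<alpha>, \<beta> \<cdot>\<^bsub>B\<^esub> onArr q k)" and ?t = "(y, onArr p k \<cdot>\<^bsub>A\<^esub> \<alpha>, \<beta>)"
      have iff: "?s \<in> facs a b \<gamma> \<longleftrightarrow> ?t \<in> facs a b \<gamma>"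
        using composite_slide[OF k \<alpha> \<beta>] p.A.homD[OF k] \<alpha> \<beta> p.onArr_hom[OF k] q.onArr_hom[OF k]
        by (auto simp: facs_def intro: p.B.Comp_hom q.B.Comp_hom)
      moreover have "(?s, ?t) \<in> fac_edges a b \<gamma>" if "?s \<in> facs a b \<gamma>"
        using fac_edgesI[OF k that \<beta>] .
      ultimately show ?thesis
        unfolding Q_def by (blast intro: rtrancl.rtrancl_into_rtrancl)
    qed
    obtain t' where t': "t' \<in> hom D (ob ?H) (ob ?B)" and eq: "\<forall>x \<in> Obj P. \<forall>\<beta> \<in> hom B (onObj q x) b.
      t' \<cdot>\<^bsub>D\<^esub> ?leg (x, \<beta>) = ar (?A x) ?B (\<lambda>s. if Q (x, projl s, \<beta>) then tt else ff)"
      by (rule ex1E[OF classify[of Q]], erule (2) Q, elim conjE, rule that)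
    from t' obtain t where t_maps: "t \<in> ?H \<rightarrow> ?B" and t'_eq: "t' = ar ?H ?B t"
      unfolding homH by (elim imageE) (rule that)
    have t: "t (Inr (composite (x, \<alpha>, \<beta>))) = tt \<longleftrightarrow> Q (x, \<alpha>, \<beta>)"
      if "x \<in> Obj P" "\<alpha> \<in> hom A a (onObj p x)" "\<beta> \<in> hom B (onObj q x) b" for x \<alpha> \<beta>
      using represents[OF t_maps that(1,3), of Q] eq that by (auto simp: t'_eq)
    \<comment> \<open>All factorisations of \<gamma> have the same composite, so \<open>t\<close>
      gives them one common value, and \<open>Q z0\<close> spreads to \<open>Q z1\<close>.\<close>
    have "t (Inr \<gamma>) = tt \<longleftrightarrow> Q z" if "z \<in> facs a b \<gamma>" for z
      using that t by (cases z) (auto simp: facs_def)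
    moreover have "Q z0" using z0 by (simp add: Q_def)
    ultimately have "Q z1" using z0 z1 by blast
    then show ?thesis by (simp add: Q_def)
  qed
  ultimately show ?thesis
    by (auto simp: linked_def)
qed

end

section \<open>Factorisations through tensor products\<close>

lemma M_cat_simps [simp]:
  "Obj (M_cat C) = lists (Obj C)" "Ident (M_cat C) xs = map (Ident C) xs"
  "gs \<cdot>\<^bsub>M_cat C\<^esub> fs = map2 (Comp C) gs fs"
  by (simp_all add: M_cat_def)

lemma M_ftor_simps [simp]: "onObj (M_ftor F) xs = map (onObj F) xs" "onArr (M_ftor F) fs = map (onArr F) fs"
  by (simp_all add: M_ftor_def)

lemma tensor_simps [simp]: "onObj (tensor V) xs = tensObjs V xs" "onArr (tensor V) fs = tensArrs V fs"
  by (simp_all add: tensor_def)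

lemma hom_M_Nil: "fs \<in> hom (M_cat C) [] ys \<longleftrightarrow> fs = [] \<and> ys = []"
  by (auto simp: hom_def M_cat_def)

lemma hom_M_Nil': "fs \<in> hom (M_cat C) xs [] \<longleftrightarrow> fs = [] \<and> xs = []"
  by (auto simp: hom_def M_cat_def)

lemma hom_M_Cons_Cons:
  "f # fs \<in> hom (M_cat C) (x # xs) (y # ys) \<longleftrightarrow> f \<in> hom C x y \<and> fs \<in> hom (M_cat C) xs ys"
  by (auto simp: hom_def M_cat_def)

lemma hom_M_Cons: "fs \<in> hom (M_cat C) (x # xs) ys \<longleftrightarrow>
    (\<exists>f fs' y ys'. fs = f # fs' \<and> ys = y # ys' \<and> f \<in> hom C x y \<and> fs' \<in> hom (M_cat C) xs ys')"
  by (auto simp: hom_def M_cat_def map_eq_Cons_conv)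

lemma hom_M_Cons': "fs \<in> hom (M_cat C) xs (y # ys) \<longleftrightarrow>
    (\<exists>f fs' x xs'. fs = f # fs' \<and> xs = x # xs' \<and> f \<in> hom C x y \<and> fs' \<in> hom (M_cat C) xs' ys)"
  by (auto simp: hom_def M_cat_def map_eq_Cons_conv)

text \<open>The entrywise description reduces the category and functor laws to those of
  \<open>C\<close>. The description by head and tail above serves the inductions along
  right-bracketed tensors.\<close>

lemma hom_M_iff: "fs \<in> hom (M_cat C) xs ys \<longleftrightarrow> length fs = length xs \<and> length ys = length xs \<and>
    (\<forall>i < length xs. fs ! i \<in> hom C (xs ! i) (ys ! i))"
proof (induction xs arbitrary: fs ys)
  case Nil
  then show ?case by (simp add: hom_M_Nil)
next
  case (Cons x xs)
  then show ?case
    by (cases fs; cases ys) (auto simp: hom_M_Cons_Cons hom_M_Nil' hom_M_Cons nth_Cons' All_less_Suc2)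
qed

lemma category_M_cat:
  assumes "category C"
  shows "category (M_cat C)"
proof -
  interpret category C by fact
  show ?thesis
  proof
    show "Src (M_cat C) f \<in> Obj (M_cat C)" "Trg (M_cat C) f \<in> Obj (M_cat C)"
      if "f \<in> Arr (M_cat C)" for f
      using that Src_closed Trg_closed by (auto simp: M_cat_def)
    show "fs \<cdot>\<^bsub>M_cat C\<^esub> Ident (M_cat C) xs = fs" "Ident (M_cat C) ys \<cdot>\<^bsub>M_cat C\<^esub> fs = fs"
      if "fs \<in> hom (M_cat C) xs ys" for fs xs ys
      using that Comp_Ident[of "fs ! _" "xs ! _" "ys ! _"] Ident_Comp[of "fs ! _" "xs ! _" "ys ! _"]
      by (auto simp: hom_M_iff intro!: nth_equalityI)
    show "(hs \<cdot>\<^bsub>M_cat C\<^esub> gs) \<cdot>\<^bsub>M_cat C\<^esub> fs = hs \<cdot>\<^bsub>M_cat C\<^esub> (gs \<cdot>\<^bsub>M_cat C\<^esub> fs)"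
      if "fs \<in> hom (M_cat C) ws xs" "gs \<in> hom (M_cat C) xs ys" "hs \<in> hom (M_cat C) ys zs"
      for fs gs hs ws xs ys zs
      using that Comp_assoc[of "fs ! i" "ws ! i" "xs ! i" "gs ! i" "ys ! i" "hs ! i" "zs ! i" for i]
      by (auto simp: hom_M_iff intro!: nth_equalityI)
  qed (auto simp: hom_M_iff in_lists_conv_set intro: Ident_hom Comp_hom)
qed

lemma cat_functor_M_ftor:
  assumes "cat_functor A B F"
  shows "cat_functor (M_cat A) (M_cat B) (M_ftor F)"
proof -
  interpret cat_functor A B F by fact
  interpret MA: category "M_cat A" by (intro category_M_cat A.category_axioms)
  interpret MB: category "M_cat B" by (intro category_M_cat B.category_axioms)
  show ?thesis
  proof
    show "onArr (M_ftor F) (gs \<cdot>\<^bsub>M_cat A\<^esub> fs) = onArr (M_ftor F) gs \<cdot>\<^bsub>M_cat B\<^esub> onArr (M_ftor F) fs"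
      if "fs \<in> hom (M_cat A) xs ys" "gs \<in> hom (M_cat A) ys zs" for fs gs xs ys zs
    proof (rule nth_equalityI)
      fix i assume "i < length (onArr (M_ftor F) (gs \<cdot>\<^bsub>M_cat A\<^esub> fs))"
      then show "onArr (M_ftor F) (gs \<cdot>\<^bsub>M_cat A\<^esub> fs) ! i
          = (onArr (M_ftor F) gs \<cdot>\<^bsub>M_cat B\<^esub> onArr (M_ftor F) fs) ! i"
        using that onArr_Comp[of "fs ! i" "xs ! i" "ys ! i" "gs ! i" "zs ! i"] by (auto simp: hom_M_iff)
    qed (use that in \<open>simp add: hom_M_iff\<close>)
  qed (auto simp: hom_M_iff in_lists_conv_set onObj_closed onArr_hom onArr_Ident)
qed

section \<open>Tensor products of lists and their coherence with the functor\<close>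

lemma tensObjs_Cons: "xs \<noteq> [] \<Longrightarrow> tensObjs V (x # xs) = x \<odot>\<^bsub>V\<^esub> tensObjs V xs"
  by (cases xs) simp_all

lemma tensArrs_Cons: "fs \<noteq> [] \<Longrightarrow> tensArrs V (f # fs) = f \<otimes>\<^bsub>V\<^esub> tensArrs V fs"
  by (cases fs) simp_all

lemma colax_Cons: "xs \<noteq> [] \<Longrightarrow> colax V W F (x # xs) =
    (Ident W (onObj F x) \<otimes>\<^bsub>W\<^esub> colax V W F xs) \<cdot>\<^bsub>W\<^esub> colax2 F x (tensObjs V xs)"
  by (cases xs) simp_all

text \<open>Strict normality makes singletons an exception to the recursion; for a nonempty tail
  these equations are uniform. This is why the inductions below split on whether the tail is
  empty.\<close>

lemmas tens_Cons = tensObjs_Cons tensArrs_Cons colax_Cons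

lemma hom_M_length: "fs \<in> hom (M_cat C) xs ys \<Longrightarrow> length fs = length xs \<and> length ys = length xs"
  by (simp add: hom_M_iff)

context monoidal_category
begin

lemma tensObjs_closed: "xs \<in> lists (Obj V) \<Longrightarrow> tensObjs V xs \<in> Obj V"
proof (induction xs)
  case (Cons x xs)
  then show ?case by (cases "xs = []") (auto simp: tens_Cons tensObj_closed)
qed (simp add: unitObj_closed)

lemma tensArrs_hom:
  "fs \<in> hom (M_cat V) xs ys \<Longrightarrow> tensArrs V fs \<in> hom V (tensObjs V xs) (tensObjs V ys)"
proof (induction xs arbitrary: fs ys)
  case Nil
  then show ?case by (simp add: hom_M_Nil Ident_hom unitObj_closed)
next
  case (Cons x xs)
  then obtain f fs' y ys' where *: "fs = f # fs'" "ys = y # ys'" "f \<in> hom V x y"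
    "fs' \<in> hom (M_cat V) xs ys'"
    by (auto simp: hom_M_Cons)
  show ?case
  proof (cases "xs = []")
    case True
    then show ?thesis using * by (simp add: hom_M_Nil)
  next
    case False
    then have "fs' \<noteq> []" "ys' \<noteq> []" using hom_M_length[OF *(4)] by auto
    then show ?thesis
      using * False Cons.IH[OF *(4)] by (simp add: tens_Cons tensArr_hom)
  qed
qed

lemma tensArrs_Ident: "xs \<in> lists (Obj V) \<Longrightarrow> tensArrs V (map (Ident V) xs) = Ident V (tensObjs V xs)"
proof (induction xs)
  case (Cons x xs)
  then show ?case
    by (cases "xs = []") (simp_all add: tens_Cons tensArr_Ident tensObjs_closed)
qed simp

lemma tensArrs_Comp:
  "fs \<in> hom (M_cat V) xs ys \<Longrightarrow> gs \<in> hom (M_cat V) ys zs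
    \<Longrightarrow> tensArrs V (map2 (Comp V) gs fs) = tensArrs V gs \<cdot> tensArrs V fs"
proof (induction xs arbitrary: fs ys gs zs)
  case Nil
  then have "fs = []" "ys = []" "gs = []" by (auto simp: hom_M_Nil)
  then show ?case using Ident_Comp[OF Ident_hom[OF unitObj_closed]] by simp
next
  case (Cons x xs)
  then obtain f fs' y ys' g gs' z zs' where *: "fs = f # fs'" "ys = y # ys'" "f \<in> hom V x y"
    "fs' \<in> hom (M_cat V) xs ys'" "gs = g # gs'" "zs = z # zs'" "g \<in> hom V y z"
    "gs' \<in> hom (M_cat V) ys' zs'"
    by (auto simp: hom_M_Cons)
  show ?case
  proof (cases "xs = []")
    case True
    then show ?thesis using * by (auto simp: hom_M_Nil)
  next
    case False
    then have ne: "fs' \<noteq> []" "ys' \<noteq> []" "gs' \<noteq> []" "map2 (Comp V) gs' fs' \<noteq> []"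
      using hom_M_length[OF *(4)] hom_M_length[OF *(8)] by (auto simp flip: length_greater_0_conv)
    show ?thesis
      using ne * Cons.IH[OF *(4,8)] interchange[OF *(3,7) tensArrs_hom[OF *(4)] tensArrs_hom[OF *(8)]]
      by (simp add: tens_Cons)
  qed
qed

lemma cat_functor_tensor: "cat_functor (M_cat V) V (tensor V)"
proof -
  interpret M: category "M_cat V" by (intro category_M_cat category_axioms)
  show ?thesis
    by unfold_locales (auto simp: tensObjs_closed tensArrs_Ident tensArrs_Comp tensArrs_hom)
qed

end

context colax_monoidal_functor
begin

lemma colax_hom: "xs \<in> lists (Obj V) \<Longrightarrow>
    colax V W F xs \<in> hom W (onObj F (tensObjs V xs)) (tensObjs W (map (onObj F) xs))"
proof (induction xs)
  case Nil
  then show ?case by (simp add: colax0_hom)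
next
  case (Cons x xs)
  then have x: "x \<in> Obj V" and xs: "xs \<in> lists (Obj V)" by auto
  show ?case
  proof (cases "xs = []")
    case True
    then show ?thesis using x by (simp add: onObj_closed W.Ident_hom)
  next
    case False
    then show ?thesis
      using x Cons.IH[OF xs] colax2_hom[OF x V.tensObjs_closed[OF xs]]
      by (auto simp: tens_Cons intro!: W.Comp_hom W.tensArr_hom W.Ident_hom onObj_closed)
  qed
qed

text \<open>Naturality of \<open>colax2\<close> moves the arrow past it, interchange isolates the
  tail in the second component, where the induction hypothesis applies, and interchange reassembles
  the result.\<close>

lemma colax_natural: "fs \<in> hom (M_cat V) xs ys \<Longrightarrow>
    colax V W F ys \<cdot>\<^bsub>W\<^esub> onArr F (tensArrs V fs) = tensArrs W (map (onArr F) fs) \<cdot>\<^bsub>W\<^esub> colax V W F xs"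
proof (induction xs arbitrary: fs ys)
  case Nil
  then have "fs = []" "ys = []" by (auto simp: hom_M_Nil)
  then show ?case
    using colax0_hom by (simp add: onArr_Ident V.unitObj_closed W.Comp_Ident W.Ident_Comp)
next
  case (Cons x xs)
  then obtain f fs' y ys' where *: "fs = f # fs'" "ys = y # ys'" and f: "f \<in> hom V x y"
    and fs': "fs' \<in> hom (M_cat V) xs ys'"
    by (auto simp: hom_M_Cons)
  interpret MV: category "M_cat V" by (intro category_M_cat V.category_axioms)
  interpret MF: cat_functor "M_cat V" "M_cat W" "M_ftor F"
    by (intro cat_functor_M_ftor cat_functor_axioms)
  note Ff = onArr_hom[OF f]
  show ?case
  proof (cases "xs = []")
    case True
    then show ?thesis using * fs' Ff by (auto simp: hom_M_Nil W.Comp_Ident W.Ident_Comp)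
  next
    case False
    then have ne: "fs' \<noteq> []" "ys' \<noteq> []"
      using hom_M_length[OF fs'] by auto
    have xs: "xs \<in> lists (Obj V)" and ys': "ys' \<in> lists (Obj V)"
      using MV.homD[OF fs'] by auto
    have xy: "x \<in> Obj V" "y \<in> Obj V" using V.homD[OF f] by auto
    note IH = Cons.IH[OF fs'] and T = V.tensArrs_hom[OF fs']
    have MF: "tensArrs W (map (onArr F) fs')
        \<in> hom W (tensObjs W (map (onObj F) xs)) (tensObjs W (map (onObj F) ys'))"
      using W.tensArrs_hom[OF MF.onArr_hom[OF fs']] by simp
    note id = W.Ident_hom[OF onObj_closed]
    note c2 = colax2_hom[OF xy(1) V.tensObjs_closed[OF xs]] colax2_hom[OF xy(2) V.tensObjs_closed[OF ys']]
    note FT = onArr_hom[OF V.tensArr_hom[OF f T]]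
    have "colax V W F (y # ys') \<cdot>\<^bsub>W\<^esub> onArr F (f \<otimes>\<^bsub>V\<^esub> tensArrs V fs')
        = (Ident W (onObj F y) \<otimes>\<^bsub>W\<^esub> colax V W F ys') \<cdot>\<^bsub>W\<^esub>
          ((onArr F f \<otimes>\<^bsub>W\<^esub> onArr F (tensArrs V fs')) \<cdot>\<^bsub>W\<^esub> colax2 F x (tensObjs V xs))"
      using ne W.Comp_assoc[OF FT c2(2) W.tensArr_hom[OF id[OF xy(2)] colax_hom[OF ys']]]
      by (simp add: tens_Cons colax2_natural[OF f T])
    also have "\<dots> = ((Ident W (onObj F y) \<cdot>\<^bsub>W\<^esub> onArr F f) \<otimes>\<^bsub>W\<^esub>
        (colax V W F ys' \<cdot>\<^bsub>W\<^esub> onArr F (tensArrs V fs'))) \<cdot>\<^bsub>W\<^esub> colax2 F x (tensObjs V xs)"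
      using W.interchange[OF Ff id[OF xy(2)] onArr_hom[OF T] colax_hom[OF ys']]
        W.Comp_assoc[OF c2(1) W.tensArr_hom[OF Ff onArr_hom[OF T]]
          W.tensArr_hom[OF id[OF xy(2)] colax_hom[OF ys']]]
      by simp
    also have "\<dots> = ((onArr F f \<cdot>\<^bsub>W\<^esub> Ident W (onObj F x)) \<otimes>\<^bsub>W\<^esub>
        (tensArrs W (map (onArr F) fs') \<cdot>\<^bsub>W\<^esub> colax V W F xs)) \<cdot>\<^bsub>W\<^esub> colax2 F x (tensObjs V xs)"
      using Ff by (simp add: IH W.Comp_Ident W.Ident_Comp)
    also have "\<dots> = (onArr F f \<otimes>\<^bsub>W\<^esub> tensArrs W (map (onArr F) fs')) \<cdot>\<^bsub>W\<^esub> colax V W F (x # xs)"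
      using False W.interchange[OF id[OF xy(1)] Ff colax_hom[OF xs] MF]
        W.Comp_assoc[OF c2(1) W.tensArr_hom[OF id[OF xy(1)] colax_hom[OF xs]] W.tensArr_hom[OF Ff MF]]
      by (simp add: tens_Cons)
    finally show ?thesis using ne by (simp add: * tens_Cons)
  qed
qed

sublocale sq: lax_square "M_cat V" V "M_cat W" W "tensor V" "M_ftor F" F "tensor W" "colax V W F"
  by (intro lax_square.intro lax_square_axioms.intro V.cat_functor_tensor W.cat_functor_tensor
      cat_functor_M_ftor cat_functor_axioms)
    (simp_all add: colax_hom colax_natural)

text \<open>The list \<open>hs\<close> forces \<open>Zs\<close> to have the length of
  \<open>Ys\<close>, so that length can be used to classify the factorisations.\<close>

lemma mem_facs: "(Zs, \<alpha>, hs) \<in> sq.facs X Ys \<gamma> \<longleftrightarrow> Zs \<in> lists (Obj V) \<and>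
    \<alpha> \<in> hom V X (tensObjs V Zs) \<and> hs \<in> hom (M_cat W) (map (onObj F) Zs) Ys \<and>
    tensArrs W hs \<cdot>\<^bsub>W\<^esub> (colax V W F Zs \<cdot>\<^bsub>W\<^esub> onArr F \<alpha>) = \<gamma>"
  by (simp add: sq.facs_def sq.composite_def)

lemma colax_pair: "x \<in> Obj V \<Longrightarrow> y \<in> Obj V \<Longrightarrow> colax V W F [x, y] = colax2 F x y"
  using colax2_hom[of x y] by (simp add: W.tensArr_Ident onObj_closed W.Ident_Comp)

section \<open>Targets of length zero and one\<close>

lemma mem_facs_Nil: "(Zs, \<alpha>, hs) \<in> sq.facs X [] \<gamma> \<longleftrightarrow>
    Zs = [] \<and> hs = [] \<and> \<alpha> \<in> hom V X \<I>\<^bsub>V\<^esub> \<and> \<gamma> = colax0 F \<cdot>\<^bsub>W\<^esub> onArr F \<alpha>"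
proof -
  have "Ident W \<I>\<^bsub>W\<^esub> \<cdot>\<^bsub>W\<^esub> (colax0 F \<cdot>\<^bsub>W\<^esub> onArr F \<alpha>) = colax0 F \<cdot>\<^bsub>W\<^esub> onArr F \<alpha>"
    if "\<alpha> \<in> hom V X \<I>\<^bsub>V\<^esub>"
    using onArr_hom[OF that] colax0_hom by (auto intro!: W.Ident_Comp W.Comp_hom)
  then show ?thesis
    by (auto simp: mem_facs hom_M_Nil')
qed

text \<open>The empty list has only its identity arrow, so all edges are loops. A discrete graph is
  connected iff it has exactly one vertex.\<close>

lemma linked_facs_Nil_iff:
  "linked (sq.facs X [] \<gamma>) (sq.fac_edges X [] \<gamma>) \<longleftrightarrow>
    (\<exists>!g. g \<in> hom V X \<I>\<^bsub>V\<^esub> \<and> \<gamma> = colax0 F \<cdot>\<^bsub>W\<^esub> onArr F g)" (is "?L \<longleftrightarrow> ?R")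
proof
  have discrete: "s = t" if "(s, t) \<in> sq.fac_edges X [] \<gamma>" for s t
  proof -
    obtain Zs \<alpha> hs where s: "s = (Zs, \<alpha>, hs)" by (cases s)
    obtain Zs' \<alpha>' hs' where t: "t = (Zs', \<alpha>', hs')" by (cases t)
    have mem: "(Zs, \<alpha>, hs) \<in> sq.facs X [] \<gamma>" "(Zs', \<alpha>', hs') \<in> sq.facs X [] \<gamma>"
      and "\<exists>ks \<in> hom (M_cat V) Zs Zs'. tensArrs V ks \<cdot>\<^bsub>V\<^esub> \<alpha> = \<alpha>'"
      using that by (auto simp: sq.fac_edges_def s t)
    then have "Ident V \<I>\<^bsub>V\<^esub> \<cdot>\<^bsub>V\<^esub> \<alpha> = \<alpha>'"
      unfolding mem_facs_Nil by (auto simp: hom_M_Nil)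
    moreover have "\<alpha> \<in> hom V X \<I>\<^bsub>V\<^esub>" using mem by (simp add: mem_facs_Nil)
    ultimately show ?thesis
      using mem V.Ident_Comp by (simp add: s t mem_facs_Nil)
  qed
  assume L: ?L
  then obtain z where z: "z \<in> sq.facs X [] \<gamma>"
    unfolding linked_def by blast
  then obtain g where g: "([], g, []) \<in> sq.facs X [] \<gamma>"
    by (cases z) (simp only: mem_facs_Nil, blast)
  show ?R
  proof (rule ex1I)
    show "g \<in> hom V X \<I>\<^bsub>V\<^esub> \<and> \<gamma> = colax0 F \<cdot>\<^bsub>W\<^esub> onArr F g"
      using g by (simp add: mem_facs_Nil)
    fix g' assume "g' \<in> hom V X \<I>\<^bsub>V\<^esub> \<and> \<gamma> = colax0 F \<cdot>\<^bsub>W\<^esub> onArr F g'"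
    then have "([], g', []) \<in> sq.facs X [] \<gamma>"
      by (simp add: mem_facs_Nil)
    from linked_invariant[OF L this g, of "\<lambda>z. z"] discrete show "g' = g"
      by auto
  qed
next
  assume ?R
  then obtain g where g: "\<And>\<alpha>. \<alpha> \<in> hom V X \<I>\<^bsub>V\<^esub> \<and> \<gamma> = colax0 F \<cdot>\<^bsub>W\<^esub> onArr F \<alpha> \<longleftrightarrow> \<alpha> = g"
    by (elim ex1E) blast
  have "sq.facs X [] \<gamma> = {([], g, [])}"
  proof (rule set_eqI)
    show "z \<in> sq.facs X [] \<gamma> \<longleftrightarrow> z \<in> {([], g, [])}" for z
      by (cases z) (auto simp: mem_facs_Nil g)
  qed
  then show ?L by (simp add: linked_def)
qed

text \<open>The factorisation through the identity is weakly initial: it is sent to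
  \<open>([Z], g, [h])\<close> by \<open>g\<close> itself.\<close>

lemma linked_facs_single:
  assumes X: "X \<in> Obj V" and \<gamma>: "\<gamma> \<in> hom W (onObj F X) y"
  shows "linked (sq.facs X [y] \<gamma>) (sq.fac_edges X [y] \<gamma>)"
proof -
  note FX = onObj_closed[OF X]
  have o: "([X], Ident V X, [\<gamma>]) \<in> sq.facs X [y] \<gamma>"
    using X \<gamma> FX W.Ident_hom[OF FX]
    by (auto simp: mem_facs hom_M_Cons_Cons hom_M_Nil V.Ident_hom onArr_Ident W.Comp_Ident)
  have edge: "(([X], Ident V X, [\<gamma>]), z) \<in> sq.fac_edges X [y] \<gamma>" if "z \<in> sq.facs X [y] \<gamma>" for z
  proof -
    from that obtain Z g h where z: "z = ([Z], g, [h])" and Z: "Z \<in> Obj V" and g: "g \<in> hom V X Z"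
      and h: "h \<in> hom W (onObj F Z) y" and eq: "h \<cdot>\<^bsub>W\<^esub> onArr F g = \<gamma>"
    proof (cases z)
      case (fields Zs \<alpha> hs)
      then show thesis
        using \<open>z \<in> _\<close> onArr_hom by (auto simp: mem_facs hom_M_Cons' hom_M_Nil' W.Ident_Comp[OF onArr_hom] intro!: that)
    qed
    show ?thesis
      using sq.fac_edgesI[of "[g]" "[X]" "[Z]" "Ident V X" "[h]" X "[y]" \<gamma>] o g h
      by (simp add: z eq hom_M_Cons_Cons hom_M_Nil V.Comp_Ident)
  qed
  show ?thesis
    unfolding linked_def
  proof (intro conjI ballI)
    fix z z' assume z: "z \<in> sq.facs X [y] \<gamma>" and z': "z' \<in> sq.facs X [y] \<gamma>"
    show "(z, z') \<in> (sq.fac_edges X [y] \<gamma> \<union> (sq.fac_edges X [y] \<gamma>)\<inverse>)\<^sup>*"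
      using edge[OF z] edge[OF z'] by (meson UnCI converseI converse_rtrancl_into_rtrancl r_into_rtrancl)
  qed (use o in blast)
qed

section \<open>Splitting off the first tensor factor\<close>

definition join :: "'a \<Rightarrow> 'o \<Rightarrow> 'b \<Rightarrow> 'o list \<times> 'a \<times> 'b list \<Rightarrow> 'o list \<times> 'a \<times> 'b list" where
  "join g Z h = (\<lambda>(Zs, \<alpha>, hs). (Z # Zs, (Ident V Z \<otimes>\<^bsub>V\<^esub> \<alpha>) \<cdot>\<^bsub>V\<^esub> g, h # hs))"

text \<open>Here \<open>s\<close> refines the second factor of a binary factorisation by factoring
  \<open>h'\<close>. Naturality of \<open>colax2\<close> at
  \<open>Ident V Z \<otimes> \<alpha>\<close> brings \<alpha> next to the coherence and arrows of
  the tail, and interchange collapses the three to \<open>h'\<close>.\<close>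

lemma join_mem_facs:
  assumes b: "(g, Z, Z', h, h') \<in> Fact_Obj V W F X \<gamma> y (tensObjs W ys)"
    and s: "s \<in> sq.facs Z' ys h'" and ys: "ys \<noteq> []"
  shows "join g Z h s \<in> sq.facs X (y # ys) \<gamma>"
proof (cases s)
  case (fields Zs \<alpha> hs)
  with s have Zs: "Zs \<in> lists (Obj V)" and \<alpha>: "\<alpha> \<in> hom V Z' (tensObjs V Zs)"
    and hs: "hs \<in> hom (M_cat W) (map (onObj F) Zs) ys"
    and h': "tensArrs W hs \<cdot>\<^bsub>W\<^esub> (colax V W F Zs \<cdot>\<^bsub>W\<^esub> onArr F \<alpha>) = h'"
    by (auto simp: mem_facs)
  from b have Z: "Z \<in> Obj V" and Z': "Z' \<in> Obj V" and g: "g \<in> hom V X (Z \<odot>\<^bsub>V\<^esub> Z')"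
    and h: "h \<in> hom W (onObj F Z) y"
    and \<gamma>: "(h \<otimes>\<^bsub>W\<^esub> h') \<cdot>\<^bsub>W\<^esub> colax2 F Z Z' \<cdot>\<^bsub>W\<^esub> onArr F g = \<gamma>"
    by (auto simp: Fact_Obj_def)
  have ne: "hs \<noteq> []" "Zs \<noteq> []" using hom_M_length[OF hs] ys by auto
  note id = V.Ident_hom[OF Z] and FZ = onObj_closed[OF Z]
  note \<alpha>' = V.tensArr_hom[OF id \<alpha>]
  note TZs = V.tensObjs_closed[OF Zs]
  note Ths = W.tensArrs_hom[OF hs]
  note col = colax_hom[OF Zs] and F\<alpha> = onArr_hom[OF \<alpha>] and Fg = onArr_hom[OF g]
  note c2 = colax2_hom[OF Z TZs] colax2_hom[OF Z Z'] and idF = W.Ident_hom[OF FZ]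
  note ty = \<alpha>' Ths col F\<alpha> Fg c2 idF h onArr_hom[OF \<alpha>'] W.tensArr_hom[OF idF col]
    W.tensArr_hom[OF h Ths] W.tensArr_hom[OF idF F\<alpha>]
  have "tensArrs W (h # hs) \<cdot>\<^bsub>W\<^esub> (colax V W F (Z # Zs) \<cdot>\<^bsub>W\<^esub> onArr F ((Ident V Z \<otimes>\<^bsub>V\<^esub> \<alpha>) \<cdot>\<^bsub>V\<^esub> g))
      = (h \<otimes>\<^bsub>W\<^esub> tensArrs W hs) \<cdot>\<^bsub>W\<^esub> ((Ident W (onObj F Z) \<otimes>\<^bsub>W\<^esub> colax V W F Zs) \<cdot>\<^bsub>W\<^esub>
        ((colax2 F Z (tensObjs V Zs) \<cdot>\<^bsub>W\<^esub> onArr F (Ident V Z \<otimes>\<^bsub>V\<^esub> \<alpha>)) \<cdot>\<^bsub>W\<^esub> onArr F g))"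
    using ne ty by (auto simp: tens_Cons onArr_Comp[OF g \<alpha>'] hom_def W.Arr_simps)
  also have "\<dots> = (((h \<otimes>\<^bsub>W\<^esub> tensArrs W hs) \<cdot>\<^bsub>W\<^esub> (Ident W (onObj F Z) \<otimes>\<^bsub>W\<^esub> colax V W F Zs)) \<cdot>\<^bsub>W\<^esub>
        (Ident W (onObj F Z) \<otimes>\<^bsub>W\<^esub> onArr F \<alpha>)) \<cdot>\<^bsub>W\<^esub> (colax2 F Z Z' \<cdot>\<^bsub>W\<^esub> onArr F g)"
    unfolding colax2_natural[OF id \<alpha>] onArr_Ident[OF Z] using ty by (auto simp: hom_def W.Arr_simps)
  also have "\<dots> = (h \<otimes>\<^bsub>W\<^esub> h') \<cdot>\<^bsub>W\<^esub> (colax2 F Z Z' \<cdot>\<^bsub>W\<^esub> onArr F g)"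
    using W.interchange[OF idF h col Ths] W.interchange[OF idF h F\<alpha> W.Comp_hom[OF col Ths]]
      W.Comp_assoc[OF F\<alpha> col Ths]
    by (simp add: W.Comp_Ident[OF h] h')
  also have "\<dots> = \<gamma>"
  proof -
    have "h' \<in> hom W (onObj F Z') (tensObjs W ys)"
      unfolding h'[symmetric] by (intro W.Comp_hom[OF _ Ths] W.Comp_hom[OF F\<alpha> col])
    from W.tensArr_hom[OF h this] \<gamma> show ?thesis
      using W.Comp_assoc[OF Fg c2(2)] by simp
  qed
  finally show ?thesis
    using Zs Z hs h ne V.Comp_hom[OF g \<alpha>']
    by (simp add: join_def fields mem_facs hom_M_Cons_Cons tens_Cons)
qed

text \<open>Forgetting which pair witnesses an arrow puts \<open>Fact\<close> into the same form as
  \<open>fac_edges\<close>.\<close>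

lemma connected_Fact_iff_linked:
  "connected_category (Fact V W F X \<gamma> Y\<^sub>1 Y\<^sub>2) \<longleftrightarrow> linked (Fact_Obj V W F X \<gamma> Y\<^sub>1 Y\<^sub>2)
    {((g, Z\<^sub>1, Z\<^sub>2, h\<^sub>1, h\<^sub>2), (g', Z\<^sub>1', Z\<^sub>2', h\<^sub>1', h\<^sub>2')).
       (g, Z\<^sub>1, Z\<^sub>2, h\<^sub>1, h\<^sub>2) \<in> Fact_Obj V W F X \<gamma> Y\<^sub>1 Y\<^sub>2 \<and>
       (g', Z\<^sub>1', Z\<^sub>2', h\<^sub>1', h\<^sub>2') \<in> Fact_Obj V W F X \<gamma> Y\<^sub>1 Y\<^sub>2 \<and>
       (\<exists>k\<^sub>1 \<in> hom V Z\<^sub>1 Z\<^sub>1'. \<exists>k\<^sub>2 \<in> hom V Z\<^sub>2 Z\<^sub>2'. (k\<^sub>1 \<otimes>\<^bsub>V\<^esub> k\<^sub>2) \<cdot>\<^bsub>V\<^esub> g = g' \<and>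
         h\<^sub>1 = h\<^sub>1' \<cdot>\<^bsub>W\<^esub> onArr F k\<^sub>1 \<and> h\<^sub>2 = h\<^sub>2' \<cdot>\<^bsub>W\<^esub> onArr F k\<^sub>2)}" (is "_ \<longleftrightarrow> linked _ ?E")
proof -
  have "(\<lambda>k. (Src (Fact V W F X \<gamma> Y\<^sub>1 Y\<^sub>2) k, Trg (Fact V W F X \<gamma> Y\<^sub>1 Y\<^sub>2) k)) `
      Arr (Fact V W F X \<gamma> Y\<^sub>1 Y\<^sub>2) = ?E"
    unfolding Fact_def by (fastforce simp: image_iff)
  then show ?thesis
    by (simp add: connected_category_linked) (simp add: Fact_def)
qed

text \<open>The joins are arranged over a connected base, the binary \<open>Fact\<close>. Over a
  point of it lie the factorisations of its \<open>h'\<close>, connected by the induction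
  hypothesis, and arrows of the base connect neighbouring fibres.\<close>

lemma linked_facs_Cons:
  assumes X: "X \<in> Obj V" and ys: "ys \<noteq> []"
    and binary: "connected_category (Fact V W F X \<gamma> y (tensObjs W ys))"
    and IH: "\<And>Z h. Z \<in> Obj V \<Longrightarrow> h \<in> hom W (onObj F Z) (tensObjs W ys)
      \<Longrightarrow> linked (sq.facs Z ys h) (sq.fac_edges Z ys h)"
  shows "linked (sq.facs X (y # ys) \<gamma>) (sq.fac_edges X (y # ys) \<gamma>)"
proof -
  let ?FO = "Fact_Obj V W F X \<gamma> y (tensObjs W ys)"
  let ?E = "sq.fac_edges X (y # ys) \<gamma>"
  let ?R = "(?E \<union> ?E\<inverse>)\<^sup>*"
  have rest: "linked (sq.facs Z' ys h') (sq.fac_edges Z' ys h')"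
    if "(g, Z, Z', h, h') \<in> ?FO" for g Z Z' h h'
    using that by (intro IH) (auto simp: Fact_Obj_def)
  have join_same: "(join g Z h s, join g Z h t) \<in> ?R"
    if b: "(g, Z, Z', h, h') \<in> ?FO" and s: "s \<in> sq.facs Z' ys h'" and t: "t \<in> sq.facs Z' ys h'"
    for g Z Z' h h' s t
  proof -
    from b have Z: "Z \<in> Obj V" and g: "g \<in> hom V X (Z \<odot>\<^bsub>V\<^esub> Z')" and h: "h \<in> hom W (onObj F Z) y"
      by (auto simp: Fact_Obj_def)
    note id = V.Ident_hom[OF Z]
    \<comment> \<open>An arrow between the tails becomes one between the joins when the identity of
      \<open>Z\<close> is put in front.\<close>
    have "(join g Z h u, join g Z h v) \<in> ?E" if uv: "(u, v) \<in> sq.fac_edges Z' ys h'" for u v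
    proof -
      obtain Zs \<alpha> hs Zs' hs' ks where u: "u = (Zs, \<alpha>, map2 (Comp W) hs' (map (onArr F) ks))"
        and v: "v = (Zs', tensArrs V ks \<cdot>\<^bsub>V\<^esub> \<alpha>, hs')"
        and uf: "u \<in> sq.facs Z' ys h'" and vf: "v \<in> sq.facs Z' ys h'"
        and ks: "ks \<in> hom (M_cat V) Zs Zs'"
        using uv by (auto simp: sq.fac_edges_def)
      have \<alpha>: "\<alpha> \<in> hom V Z' (tensObjs V Zs)" and hs': "hs' \<in> hom (M_cat W) (map (onObj F) Zs') ys"
        using uf vf by (auto simp: u v mem_facs)
      have ne: "ks \<noteq> []" using hom_M_length[OF ks] hom_M_length[OF hs'] ys by auto
      note T = V.tensArrs_hom[OF ks]
      have "tensArrs V (Ident V Z # ks) \<cdot>\<^bsub>V\<^esub> ((Ident V Z \<otimes>\<^bsub>V\<^esub> \<alpha>) \<cdot>\<^bsub>V\<^esub> g)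
          = (Ident V Z \<otimes>\<^bsub>V\<^esub> (tensArrs V ks \<cdot>\<^bsub>V\<^esub> \<alpha>)) \<cdot>\<^bsub>V\<^esub> g"
        using ne V.Comp_assoc[OF g V.tensArr_hom[OF id \<alpha>] V.tensArr_hom[OF id T]]
          V.interchange[OF id id \<alpha> T] V.Comp_Ident[OF id]
        by (simp add: tens_Cons)
      moreover have "h \<cdot>\<^bsub>W\<^esub> onArr F (Ident V Z) = h"
        using h by (simp add: onArr_Ident[OF Z] W.Comp_Ident)
      moreover have "Ident V Z # ks \<in> hom (M_cat V) (Z # Zs) (Z # Zs')"
        using id ks by (simp add: hom_M_Cons_Cons)
      ultimately show ?thesis
        using join_mem_facs[OF b uf ys] join_mem_facs[OF b vf ys]
        by (auto simp: sq.fac_edges_def join_def u v intro!: bexI[of _ "Ident V Z # ks"])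
    qed
    then have "linked (join g Z h ` sq.facs Z' ys h') ?E"
      by (rule linked_map[OF rest[OF b] refl])
    then show ?thesis using s t by (auto simp: linked_def)
  qed
  \<comment> \<open>By \<open>join_same\<close> the component of a join depends only on its binary part, and by \<open>\<Phi>_edge\<close>
    below it is constant along arrows of the binary \<open>Fact\<close>.\<close>
  define \<Phi> where "\<Phi> = (\<lambda>z (g, Z, Z', h, h'). \<forall>s \<in> sq.facs Z' ys h'. (join g Z h s, z) \<in> ?R)"
  have \<Phi>_iff: "\<Phi> z (g, Z, Z', h, h') \<longleftrightarrow> (join g Z h s, z) \<in> ?R"
    if "(g, Z, Z', h, h') \<in> ?FO" "s \<in> sq.facs Z' ys h'" for z g Z Z' h h' s
    unfolding \<Phi>_def prod.case using join_same[OF that(1) _ that(2)] that(2)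
    by (blast intro: rtrancl_trans)
  have \<Phi>_edge: "\<Phi> z (g, Z, Z', h, h') \<longleftrightarrow> \<Phi> z (g\<^sub>1, Z\<^sub>1, Z\<^sub>1', h\<^sub>1, h\<^sub>1')"
    if b: "(g, Z, Z', h, h') \<in> ?FO" and b1: "(g\<^sub>1, Z\<^sub>1, Z\<^sub>1', h\<^sub>1, h\<^sub>1') \<in> ?FO"
      and k1: "k\<^sub>1 \<in> hom V Z Z\<^sub>1" and k2: "k\<^sub>2 \<in> hom V Z' Z\<^sub>1'" and geq: "(k\<^sub>1 \<otimes>\<^bsub>V\<^esub> k\<^sub>2) \<cdot>\<^bsub>V\<^esub> g = g\<^sub>1"
      and heq: "h = h\<^sub>1 \<cdot>\<^bsub>W\<^esub> onArr F k\<^sub>1" "h' = h\<^sub>1' \<cdot>\<^bsub>W\<^esub> onArr F k\<^sub>2"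
    for z g Z Z' h h' g\<^sub>1 Z\<^sub>1 Z\<^sub>1' h\<^sub>1 h\<^sub>1' k\<^sub>1 k\<^sub>2
  proof -
    \<comment> \<open>One point in each fibre suffices. Precomposing a factorisation of the new
      second leg with \<open>k\<^sub>2\<close> gives one of the old, and the two joins are related
      by \<open>k\<^sub>1\<close> followed by identities.\<close>
    obtain Zs \<alpha> hs where t: "(Zs, \<alpha>, hs) \<in> sq.facs Z\<^sub>1' ys h\<^sub>1'"
      using rest[OF b1] by (auto simp: linked_def)
    then have Zs: "Zs \<in> lists (Obj V)" and \<alpha>: "\<alpha> \<in> hom V Z\<^sub>1' (tensObjs V Zs)"
      and hs: "hs \<in> hom (M_cat W) (map (onObj F) Zs) ys"
      by (auto simp: mem_facs)
    have s: "(Zs, \<alpha> \<cdot>\<^bsub>V\<^esub> k\<^sub>2, hs) \<in> sq.facs Z' ys h'"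
      using sq.facs_precomp[OF t k2] by (simp add: heq)
    have g: "g \<in> hom V X (Z \<odot>\<^bsub>V\<^esub> Z')" using b by (simp add: Fact_Obj_def)
    have Z1: "Z\<^sub>1 \<in> Obj V" using b1 by (simp add: Fact_Obj_def)
    let ?ks = "k\<^sub>1 # map (Ident V) Zs"
    have ks: "?ks \<in> hom (M_cat V) (Z # Zs) (Z\<^sub>1 # Zs)"
      using k1 sq.p.A.Ident_hom[of Zs] Zs by (simp add: hom_M_Cons_Cons)
    have ne: "Zs \<noteq> []" using hom_M_length[OF hs] ys by auto
    note id = V.Ident_hom[OF V.tensObjs_closed[OF Zs]] and id1 = V.Ident_hom[OF Z1]
    have "tensArrs V ?ks \<cdot>\<^bsub>V\<^esub> ((Ident V Z \<otimes>\<^bsub>V\<^esub> (\<alpha> \<cdot>\<^bsub>V\<^esub> k\<^sub>2)) \<cdot>\<^bsub>V\<^esub> g) = (k\<^sub>1 \<otimes>\<^bsub>V\<^esub> (\<alpha> \<cdot>\<^bsub>V\<^esub> k\<^sub>2)) \<cdot>\<^bsub>V\<^esub> g"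
    proof -
      have idZ: "Ident V Z \<in> hom V Z Z" using V.homD[OF k1] by (simp add: V.Ident_hom)
      note \<alpha>k = V.Comp_hom[OF k2 \<alpha>]
      show ?thesis
        using ne V.Comp_assoc[OF g V.tensArr_hom[OF idZ \<alpha>k] V.tensArr_hom[OF k1 id]]
          V.interchange[OF idZ k1 \<alpha>k id]
        by (simp add: tens_Cons V.tensArrs_Ident[OF Zs] V.Comp_Ident[OF k1] V.Ident_Comp[OF \<alpha>k])
    qed
    also have "\<dots> = (Ident V Z\<^sub>1 \<otimes>\<^bsub>V\<^esub> \<alpha>) \<cdot>\<^bsub>V\<^esub> g\<^sub>1"
      using V.Comp_assoc[OF g V.tensArr_hom[OF k1 k2] V.tensArr_hom[OF id1 \<alpha>]]
        V.interchange[OF k1 id1 k2 \<alpha>]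
      by (simp add: geq V.Ident_Comp[OF k1])
    finally have "tensArrs V ?ks \<cdot>\<^bsub>V\<^esub> ((Ident V Z \<otimes>\<^bsub>V\<^esub> (\<alpha> \<cdot>\<^bsub>V\<^esub> k\<^sub>2)) \<cdot>\<^bsub>V\<^esub> g)
        = (Ident V Z\<^sub>1 \<otimes>\<^bsub>V\<^esub> \<alpha>) \<cdot>\<^bsub>V\<^esub> g\<^sub>1" .
    moreover have "map2 (Comp W) hs (map (onArr F) (map (Ident V) Zs)) = hs"
    proof -
      have "map (onArr F) (map (Ident V) Zs) = map (Ident W) (map (onObj F) Zs)"
        using Zs by (auto simp: onArr_Ident)
      then show ?thesis using sq.q.B.Comp_Ident[OF hs] by (simp del: map_map)
    qed
    ultimately have "(join g Z h (Zs, \<alpha> \<cdot>\<^bsub>V\<^esub> k\<^sub>2, hs), join g\<^sub>1 Z\<^sub>1 h\<^sub>1 (Zs, \<alpha>, hs)) \<in> ?E"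
      using join_mem_facs[OF b s ys] join_mem_facs[OF b1 t ys] ks
      by (auto simp: sq.fac_edges_def join_def heq simp del: map_map intro!: bexI[of _ ?ks])
    then show ?thesis
      unfolding \<Phi>_iff[OF b s] \<Phi>_iff[OF b1 t]
      by (meson UnI1 UnI2 converseI converse_rtrancl_into_rtrancl)
  qed
  \<comment> \<open>Take the tensor of the tail as second factor \<open>Z'\<close>; the tail is then
    recovered by a factorisation of \<open>h'\<close> through the identity of
    \<open>Z'\<close>.\<close>
  have split: "\<exists>g Z Z' h h' s. (g, Z, Z', h, h') \<in> ?FO \<and> s \<in> sq.facs Z' ys h' \<and> z = join g Z h s"
    if z: "z \<in> sq.facs X (y # ys) \<gamma>" for z
  proof -
    obtain Zs' \<alpha> hs' where z_eq: "z = (Zs', \<alpha>, hs')" by (cases z)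
    with z obtain Z Zs h hs where eqs: "Zs' = Z # Zs" "hs' = h # hs" and Z: "Z \<in> Obj V"
      and Zs: "Zs \<in> lists (Obj V)" and \<alpha>: "\<alpha> \<in> hom V X (tensObjs V (Z # Zs))"
      and h: "h \<in> hom W (onObj F Z) y" and hs: "hs \<in> hom (M_cat W) (map (onObj F) Zs) ys"
      and \<gamma>: "tensArrs W (h # hs) \<cdot>\<^bsub>W\<^esub> (colax V W F (Z # Zs) \<cdot>\<^bsub>W\<^esub> onArr F \<alpha>) = \<gamma>"
      by (auto simp: mem_facs hom_M_Cons' in_lists_conv_set)
    have ne: "Zs \<noteq> []" "hs \<noteq> []" using hom_M_length[OF hs] ys by auto
    let ?T = "tensObjs V Zs"
    let ?h' = "tensArrs W hs \<cdot>\<^bsub>W\<^esub> colax V W F Zs"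
    note T = V.tensObjs_closed[OF Zs] and col = colax_hom[OF Zs] and Ths = W.tensArrs_hom[OF hs]
    have \<alpha>': "\<alpha> \<in> hom V X (Z \<odot>\<^bsub>V\<^esub> ?T)" using \<alpha> ne by (simp add: tens_Cons)
    note F\<alpha> = onArr_hom[OF \<alpha>'] and c2 = colax2_hom[OF Z T] and idF = W.Ident_hom[OF onObj_closed[OF Z]]
    have "(h \<otimes>\<^bsub>W\<^esub> ?h') \<cdot>\<^bsub>W\<^esub> colax2 F Z ?T \<cdot>\<^bsub>W\<^esub> onArr F \<alpha> = \<gamma>"
      using ne \<gamma> W.interchange[OF idF h col Ths] F\<alpha> c2 W.tensArr_hom[OF idF col] W.tensArr_hom[OF h Ths]
      by (auto simp: tens_Cons W.Comp_Ident[OF h] hom_def W.Arr_simps)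
    then have "(\<alpha>, Z, ?T, h, ?h') \<in> ?FO"
      using Z T \<alpha>' h W.Comp_hom[OF col Ths] by (auto simp: Fact_Obj_def)
    moreover have "(Zs, Ident V ?T, hs) \<in> sq.facs ?T ys ?h'"
      using Zs T hs col by (auto simp: mem_facs V.Ident_hom onArr_Ident W.Comp_Ident)
    moreover have "z = join \<alpha> Z h (Zs, Ident V ?T, hs)"
      using Z T \<alpha>' by (simp add: join_def z_eq eqs V.tensArr_Ident V.Ident_Comp)
    ultimately show ?thesis by blast
  qed
  note linked_FO = binary[unfolded connected_Fact_iff_linked]
  have "(z\<^sub>0, z\<^sub>1) \<in> ?R" if z0: "z\<^sub>0 \<in> sq.facs X (y # ys) \<gamma>" and z1: "z\<^sub>1 \<in> sq.facs X (y # ys) \<gamma>" for z\<^sub>0 z\<^sub>1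
  proof -
    obtain g Z Z' h h' s where 0: "(g, Z, Z', h, h') \<in> ?FO" "s \<in> sq.facs Z' ys h'" "z\<^sub>0 = join g Z h s"
      using split[OF z0] by blast
    obtain g\<^sub>1 Z\<^sub>1 Z\<^sub>1' h\<^sub>1 h\<^sub>1' t where 1: "(g\<^sub>1, Z\<^sub>1, Z\<^sub>1', h\<^sub>1, h\<^sub>1') \<in> ?FO" "t \<in> sq.facs Z\<^sub>1' ys h\<^sub>1'"
      "z\<^sub>1 = join g\<^sub>1 Z\<^sub>1 h\<^sub>1 t"
      using split[OF z1] by blast
    have "\<Phi> z\<^sub>1 (g, Z, Z', h, h') = \<Phi> z\<^sub>1 (g\<^sub>1, Z\<^sub>1, Z\<^sub>1', h\<^sub>1, h\<^sub>1')"
      by (rule linked_invariant[OF linked_FO 0(1) 1(1)]) (auto dest: \<Phi>_edge)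
    then show ?thesis
      unfolding \<Phi>_iff[OF 0(1,2)] \<Phi>_iff[OF 1(1,2)] by (simp add: 0(3) 1(3))
  qed
  moreover have "sq.facs X (y # ys) \<gamma> \<noteq> {}"
  proof -
    obtain g Z Z' h h' where b: "(g, Z, Z', h, h') \<in> ?FO"
      using linked_FO by (auto simp: linked_def)
    then obtain s where "s \<in> sq.facs Z' ys h'"
      using rest[OF b] by (auto simp: linked_def)
    then show ?thesis using join_mem_facs[OF b _ ys] by blast
  qed
  ultimately show ?thesis by (simp add: linked_def)
qed

text \<open>On lists of length two, \<open>hd\<close> and \<open>last\<close> unpack the pair. The
  resulting map is onto and preserves edges, which is enough to transport connectedness.\<close>

lemma connected_Fact_if_linked_facs:
  assumes "linked (sq.facs X [Y\<^sub>1, Y\<^sub>2] \<gamma>) (sq.fac_edges X [Y\<^sub>1, Y\<^sub>2] \<gamma>)"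
  shows "connected_category (Fact V W F X \<gamma> Y\<^sub>1 Y\<^sub>2)"
  unfolding connected_Fact_iff_linked
proof (rule linked_map[OF assms])
  let ?m = "\<lambda>(Zs, g, hs). (g, hd Zs, last Zs, hd hs, last hs)"
  have pair: "(Zs, g, hs) \<in> sq.facs X [Y\<^sub>1, Y\<^sub>2] \<gamma> \<longleftrightarrow> (\<exists>Z\<^sub>1 Z\<^sub>2 h\<^sub>1 h\<^sub>2. Zs = [Z\<^sub>1, Z\<^sub>2] \<and> hs = [h\<^sub>1, h\<^sub>2] \<and>
      (g, Z\<^sub>1, Z\<^sub>2, h\<^sub>1, h\<^sub>2) \<in> Fact_Obj V W F X \<gamma> Y\<^sub>1 Y\<^sub>2)" for Zs g hs
  proof -
    have "(h\<^sub>1 \<otimes>\<^bsub>W\<^esub> h\<^sub>2) \<cdot>\<^bsub>W\<^esub> (colax V W F [Z\<^sub>1, Z\<^sub>2] \<cdot>\<^bsub>W\<^esub> onArr F g)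
        = (h\<^sub>1 \<otimes>\<^bsub>W\<^esub> h\<^sub>2) \<cdot>\<^bsub>W\<^esub> colax2 F Z\<^sub>1 Z\<^sub>2 \<cdot>\<^bsub>W\<^esub> onArr F g"
      if "Z\<^sub>1 \<in> Obj V" "Z\<^sub>2 \<in> Obj V" "g \<in> hom V X (Z\<^sub>1 \<odot>\<^bsub>V\<^esub> Z\<^sub>2)" "h\<^sub>1 \<in> hom W (onObj F Z\<^sub>1) Y\<^sub>1"
        "h\<^sub>2 \<in> hom W (onObj F Z\<^sub>2) Y\<^sub>2" for Z\<^sub>1 Z\<^sub>2 h\<^sub>1 h\<^sub>2
      unfolding colax_pair[OF that(1,2)]
      using W.Comp_assoc[OF onArr_hom[OF that(3)] colax2_hom[OF that(1,2)] W.tensArr_hom[OF that(4,5)]]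
      by simp
    then show ?thesis
      by (auto simp: mem_facs hom_M_Cons' hom_M_Nil' Fact_Obj_def simp del: colax.simps)
  qed
  show "Fact_Obj V W F X \<gamma> Y\<^sub>1 Y\<^sub>2 = ?m ` sq.facs X [Y\<^sub>1, Y\<^sub>2] \<gamma>"
  proof (intro set_eqI iffI)
    fix b assume b: "b \<in> Fact_Obj V W F X \<gamma> Y\<^sub>1 Y\<^sub>2"
    obtain g Z\<^sub>1 Z\<^sub>2 h\<^sub>1 h\<^sub>2 where b_eq: "b = (g, Z\<^sub>1, Z\<^sub>2, h\<^sub>1, h\<^sub>2)" by (cases b)
    then have "([Z\<^sub>1, Z\<^sub>2], g, [h\<^sub>1, h\<^sub>2]) \<in> sq.facs X [Y\<^sub>1, Y\<^sub>2] \<gamma>" using b by (simp add: pair)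
    then show "b \<in> ?m ` sq.facs X [Y\<^sub>1, Y\<^sub>2] \<gamma>" by (rule rev_image_eqI) (simp add: b_eq)
  qed (auto simp: pair)
  show "(?m u, ?m v) \<in> {((g, Z\<^sub>1, Z\<^sub>2, h\<^sub>1, h\<^sub>2), (g', Z\<^sub>1', Z\<^sub>2', h\<^sub>1', h\<^sub>2')).
       (g, Z\<^sub>1, Z\<^sub>2, h\<^sub>1, h\<^sub>2) \<in> Fact_Obj V W F X \<gamma> Y\<^sub>1 Y\<^sub>2 \<and>
       (g', Z\<^sub>1', Z\<^sub>2', h\<^sub>1', h\<^sub>2') \<in> Fact_Obj V W F X \<gamma> Y\<^sub>1 Y\<^sub>2 \<and>
       (\<exists>k\<^sub>1 \<in> hom V Z\<^sub>1 Z\<^sub>1'. \<exists>k\<^sub>2 \<in> hom V Z\<^sub>2 Z\<^sub>2'. (k\<^sub>1 \<otimes>\<^bsub>V\<^esub> k\<^sub>2) \<cdot>\<^bsub>V\<^esub> g = g' \<and>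
         h\<^sub>1 = h\<^sub>1' \<cdot>\<^bsub>W\<^esub> onArr F k\<^sub>1 \<and> h\<^sub>2 = h\<^sub>2' \<cdot>\<^bsub>W\<^esub> onArr F k\<^sub>2)}"
    if "(u, v) \<in> sq.fac_edges X [Y\<^sub>1, Y\<^sub>2] \<gamma>" for u v
    using that by (auto simp: sq.fac_edges_def pair hom_M_Cons hom_M_Nil) blast
qed

text \<open>The induction on \<open>Ys\<close> generalises over \<open>X\<close> and \<gamma>,
  because the tail is needed at the second factor and second leg of every binary
  factorisation.\<close>

lemma linked_facs:
  assumes nullary: "\<And>X \<gamma>. X \<in> Obj V \<Longrightarrow> \<gamma> \<in> hom W (onObj F X) \<I>\<^bsub>W\<^esub>
      \<Longrightarrow> \<exists>!g. g \<in> hom V X \<I>\<^bsub>V\<^esub> \<and> \<gamma> = colax0 F \<cdot>\<^bsub>W\<^esub> onArr F g"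
    and binary: "\<And>X Y\<^sub>1 Y\<^sub>2 \<gamma>. X \<in> Obj V \<Longrightarrow> Y\<^sub>1 \<in> Obj W \<Longrightarrow> Y\<^sub>2 \<in> Obj W
      \<Longrightarrow> \<gamma> \<in> hom W (onObj F X) (Y\<^sub>1 \<odot>\<^bsub>W\<^esub> Y\<^sub>2) \<Longrightarrow> connected_category (Fact V W F X \<gamma> Y\<^sub>1 Y\<^sub>2)"
  shows "X \<in> Obj V \<Longrightarrow> Ys \<in> lists (Obj W) \<Longrightarrow> \<gamma> \<in> hom W (onObj F X) (tensObjs W Ys)
    \<Longrightarrow> linked (sq.facs X Ys \<gamma>) (sq.fac_edges X Ys \<gamma>)"
proof (induction Ys arbitrary: X \<gamma>)
  case Nil
  then show ?case using nullary by (simp add: linked_facs_Nil_iff)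
next
  case (Cons y ys)
  show ?case
  proof (cases "ys = []")
    case True
    then show ?thesis using Cons.prems by (simp add: linked_facs_single)
  next
    case False
    then show ?thesis
      using Cons by (intro linked_facs_Cons binary) (auto simp: tens_Cons W.tensObjs_closed)
  qed
qed

end

theorem proposition4p5p1:
  fixes \<kappa> :: "'k rel"
    and V :: "('o, 'a) moncat" and W :: "('p, 'b) moncat"
    and F :: "('o, 'a, 'p, 'b) colax_ftor"
  assumes "accommodates_Set \<kappa> TYPE('a + 'b) TYPE('d) TYPE('e)"
    and "locally_small \<kappa> V" and "locally_small \<kappa> W"
    and "colax_monoidal_functor V W F"
  shows "exact_colax \<kappa> TYPE('d) TYPE('e) V W F \<longleftrightarrow>
    (\<forall>X \<in> Obj V. \<forall>f \<in> hom W (onObj F X) \<I>\<^bsub>W\<^esub>.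
       \<exists>!g. g \<in> hom V X \<I>\<^bsub>V\<^esub> \<and> f = colax0 F \<cdot>\<^bsub>W\<^esub> onArr F g) \<and>
    (\<forall>X \<in> Obj V. \<forall>Y\<^sub>1 \<in> Obj W. \<forall>Y\<^sub>2 \<in> Obj W. \<forall>f \<in> hom W (onObj F X) (Y\<^sub>1 \<odot>\<^bsub>W\<^esub> Y\<^sub>2).
       connected_category (Fact V W F X f Y\<^sub>1 Y\<^sub>2))"
    (is "_ \<longleftrightarrow> ?nullary \<and> ?binary")
proof -
  interpret colax_monoidal_functor V W F by fact
  show ?thesis
    unfolding exact_colax_def
  proof (intro iffI conjI ballI)
    assume "exact_square \<kappa> TYPE('d) TYPE('e) (M_cat V) V (M_cat W) W
      (tensor V) (M_ftor F) F (tensor W) (colax V W F)"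
    \<comment> \<open>Only the targets \<open>[]\<close> and \<open>[Y\<^sub>1, Y\<^sub>2]\<close>
      are used; they give the two conditions.\<close>
    note linked = sq.exact_squareD[OF assms(1-3) this]
    show "\<exists>!g. g \<in> hom V X \<I>\<^bsub>V\<^esub> \<and> f = colax0 F \<cdot>\<^bsub>W\<^esub> onArr F g"
      if "X \<in> Obj V" "f \<in> hom W (onObj F X) \<I>\<^bsub>W\<^esub>" for X f
      using linked[of X "[]" f] that by (simp add: linked_facs_Nil_iff)
    show "connected_category (Fact V W F X f Y\<^sub>1 Y\<^sub>2)"
      if "X \<in> Obj V" "Y\<^sub>1 \<in> Obj W" "Y\<^sub>2 \<in> Obj W" "f \<in> hom W (onObj F X) (Y\<^sub>1 \<odot>\<^bsub>W\<^esub> Y\<^sub>2)" for X Y\<^sub>1 Y\<^sub>2 f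
      using linked[of X "[Y\<^sub>1, Y\<^sub>2]" f] that by (intro connected_Fact_if_linked_facs) simp
  next
    assume "?nullary \<and> ?binary"
    then show "exact_square \<kappa> TYPE('d) TYPE('e) (M_cat V) V (M_cat W) W
        (tensor V) (M_ftor F) F (tensor W) (colax V W F)"
      by (intro sq.exact_squareI linked_facs) auto
  qed
qed

end
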